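(* Let $d\ge 4$ be an integer, $\beta>-1/2$ and $a>0$. Then $$\lim_{\lambda\to\infty}S_\lambda(u_{\beta,a})(x)=u_{\beta,a}(x)\quad\text{for a.e. }x\in\mathbb{T}^d.$$
   Context: $\mathbb{T}^d$ is identified with $(-1/2,1/2]^d\subset\mathbb{R}^d$; $|\cdot|$ is the Euclidean norm and $mx$ denotes the inner product. For $\beta>-1$, $a>0$: $U_{\beta,a}(x)=(a^2-|x|^2)^{\beta}$ if $|x|<a$ and $U_{\beta,a}(x)=0$ if $|x|\ge a$ ($x\in\mathbb{R}^d$), and $u_{\beta,a}(x)=\sum_{m\in\mathbb{Z}^d}U_{\beta,a}(x+m)$, $x\in\mathbb{T}^d$. For integrable $f$ on $\mathbb{T}^d$: $\hat f(m)=\int_{\mathbb{T}^d}f(x)e^{-2\pi imx}\,dx$ and $S_\lambda(f)(x)=\sum_{m\in\mathbb{Z}^d,\,|m|<\lambda}\hat f(m)e^{2\pi imx}$. Here $\lambda$ is a real parameter. *)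

theory Defs
  imports "HOL-Analysis.Analysis"
begin

text \<open>The dimension \<open>d\<close> is \<open>CARD('d)\<close> for the finite index type \<open>'d\<close> of \<open>real ^ 'd\<close>. The
  torus is represented by its fundamental domain, a half-open cube.\<close>

definition torus :: "(real ^ 'd) set" where
  "torus = {x. \<forall>i. - 1/2 < x $ i \<and> x $ i \<le> 1/2}"

definition int_lattice :: "(real ^ 'd) set" where
  "int_lattice = {m. \<forall>i. m $ i \<in> \<int>}"

definition bigU :: "real \<Rightarrow> real \<Rightarrow> real ^ 'd \<Rightarrow> real" where
  "bigU \<beta> a x = (if norm x < a then (a\<^sup>2 - (norm x)\<^sup>2) powr \<beta> else 0)"

text \<open>For each \<open>x\<close> only finitely many terms of the following sum are nonzero.\<close>

definition periodU :: "real \<Rightarrow> real \<Rightarrow> real ^ 'd \<Rightarrow> real" where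
  "periodU \<beta> a x = (\<Sum>\<^sub>\<infinity>m\<in>int_lattice. bigU \<beta> a (x + m))"

definition fourier_coeff :: "(real ^ 'd \<Rightarrow> complex) \<Rightarrow> real ^ 'd \<Rightarrow> complex" where
  "fourier_coeff f m =
     (LINT x|lebesgue_on torus. f x * exp (- 2 * of_real pi * \<i> * of_real (m \<bullet> x)))"

text \<open>The index set of the partial sum is finite, so \<open>sum\<close> takes its intended value.\<close>

definition spherical_sum :: "real \<Rightarrow> (real ^ 'd \<Rightarrow> complex) \<Rightarrow> real ^ 'd \<Rightarrow> complex" where
  "spherical_sum r f x =
     (\<Sum>m\<in>{m \<in> int_lattice. norm m < r}.
        fourier_coeff f m * exp (2 * of_real pi * \<i> * of_real (m \<bullet> x)))"

end

(*
  The singularity (a^2 - |x|^2)^\<beta> with \<beta> > -1/2 is square integrable with a margin, so u has a small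
  amount of L^2 smoothness: ||u(. + h) - u||_2 = O(|h|^\<eta>) for some \<eta> > 0. By Bessel's inequality,
  averaged over shifts h along the axes, the Fourier coefficients satisfy
  \<Sum>_{|m| \<ge> R} |c(m)|^2 = O(R^(-2\<eta>)). Grouping the frequencies into the spheres |m|^2 = n makes the
  spherical sums the partial sums of an orthogonal series whose dyadic blocks decay geometrically in mean
  square, and the Rademacher--Menshov chaining argument gives almost everywhere convergence. Since
  trigonometric polynomials are dense in L^2, the spherical sums also converge to u in L^2, which
  identifies the limit.
*)

theory Submission
  imports Defs
begin

section \<open>Characters and integration over the torus\<close>

text \<open>The strict inequality \<beta> > -1/2 leaves room for some \<eta> > 0 with 2 (\<beta> -
  \<eta>) > -1. A difference of the singularity over a step h costs |h|^\<eta> times the same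
  singularity with exponent \<beta> - \<eta>, which is still square integrable; no pointwise
  asymptotics of the coefficients are involved. A single shift h does not see the frequencies for
  which m h is an integer, and averaging over the length of the shift removes this blind spot. The
  maximal inequality over the 2^k spheres of a dyadic block loses a factor (k + 1)^2, which any
  geometric rate absorbs. Grouping by |m|^2 = n is lossless, since |m|^2 is an integer on the
  lattice: every spherical sum with a positive real radius is an ordinary partial sum of the grouped
  series. Shifts leave the fundamental cube, so translation arguments are carried out for compactly
  supported functions on Euclidean space and transferred to the torus by summing over lattice
  translates.\<close>

definition character :: "real ^ 'd \<Rightarrow> real ^ 'd \<Rightarrow> complex" where
  "character m x = cis (2 * pi * (m \<bullet> x))"

lemma norm_character [simp]: "norm (character m x) = 1"
  by (simp add: character_def)

lemma character_0 [simp]: "character 0 x = 1" "character m 0 = 1"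
  by (simp_all add: character_def)

lemma character_add: "character (m + n) x = character m x * character n x"
  by (simp add: character_def cis_mult inner_add_left algebra_simps)

lemma character_add_right: "character m (x + y) = character m x * character m y"
  by (simp add: character_def cis_mult inner_add_right algebra_simps)

lemma character_minus: "character (- m) x = cnj (character m x)"
  by (simp add: character_def cis_cnj)

lemma continuous_character [continuous_intros]: "continuous_on A (character m)"
  unfolding character_def by (intro continuous_intros)

lemma borel_measurable_character [measurable]: "character m \<in> borel_measurable borel"
  by (intro borel_measurable_continuous_onI continuous_character)

section \<open>The integer lattice and its fundamental cube\<close>

lemma int_lattice_0 [simp]: "0 \<in> int_lattice"
  by (simp add: int_lattice_def)

lemma int_lattice_add: "m \<in> int_lattice \<Longrightarrow> n \<in> int_lattice \<Longrightarrow> m + n \<in> int_lattice"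
  by (simp add: int_lattice_def)

lemma int_lattice_minus: "m \<in> int_lattice \<Longrightarrow> - m \<in> int_lattice"
  by (simp add: int_lattice_def)

lemma int_lattice_diff: "m \<in> int_lattice \<Longrightarrow> n \<in> int_lattice \<Longrightarrow> m - n \<in> int_lattice"
  by (simp add: int_lattice_def)

lemma inner_int_lattice: "m \<in> int_lattice \<Longrightarrow> n \<in> int_lattice \<Longrightarrow> m \<bullet> n \<in> \<int>"
  by (auto simp: int_lattice_def inner_vec_def intro!: Ints_sum Ints_mult)

lemma character_int_lattice:
  assumes "m \<in> int_lattice" "k \<in> int_lattice"
  shows "character m k = 1"
  using inner_int_lattice[OF assms] by (metis Ints_cases character_def cis_multiple_2pi Ints_of_int)

lemma character_shift:
  assumes "m \<in> int_lattice" "k \<in> int_lattice"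
  shows "character m (x + k) = character m x"
  using assms by (simp add: character_add_right character_int_lattice)

lemma finite_int_lattice_le: "finite {m \<in> (int_lattice :: (real ^ 'd) set). norm m \<le> r}"
proof -
  define A where "A = {x \<in> \<int>. \<bar>x\<bar> \<le> r}"
  have "finite A"
    unfolding A_def by (rule finite_abs_int_segment)
  hence "finite ((\<lambda>f. (\<chi> i. f i) :: real ^ 'd) ` PiE UNIV (\<lambda>_. A))"
    by (intro finite_imageI finite_PiE) auto
  moreover have "{m \<in> (int_lattice :: (real ^ 'd) set). norm m \<le> r}
      \<subseteq> (\<lambda>f. (\<chi> i. f i)) ` PiE UNIV (\<lambda>_. A)"
  proof safe
    fix m :: "real ^ 'd" assume m: "m \<in> int_lattice" "norm m \<le> r"
    have "m $ i \<in> A" for i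
      using m component_le_norm_cart[of m i] by (auto simp: A_def int_lattice_def)
    then show "m \<in> (\<lambda>f. (\<chi> i. f i)) ` PiE UNIV (\<lambda>_. A)"
      by (intro image_eqI[of _ _ "\<lambda>i. m $ i"]) auto
  qed
  ultimately show ?thesis
    by (rule rev_finite_subset)
qed

lemma torus_tile: "\<exists>!k. k \<in> int_lattice \<and> x - k \<in> (torus :: (real ^ 'd) set)"
proof (rule ex1I)
  \<comment> \<open>The cube contains its right faces but not its left ones, hence the ceiling: in
    each coordinate k must satisfy x - 1/2 \<le> k < x + 1/2.\<close>
  define k :: "real ^ 'd" where "k = (\<chi> i. of_int \<lceil>x $ i - 1/2\<rceil>)"
  have "- 1/2 < x $ i - k $ i \<and> x $ i - k $ i \<le> 1/2" for i
    unfolding k_def vec_lambda_beta by linarith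
  then show "k \<in> int_lattice \<and> x - k \<in> torus"
    by (simp add: int_lattice_def torus_def k_def)
next
  fix m assume m: "m \<in> int_lattice \<and> x - m \<in> torus"
  have "m $ i = of_int \<lceil>x $ i - 1/2\<rceil>" for i
  proof -
    obtain z where z: "m $ i = of_int z"
      using m by (auto simp: int_lattice_def elim: Ints_cases)
    have "- 1/2 < x $ i - m $ i" "x $ i - m $ i \<le> 1/2"
      using m by (auto simp: torus_def)
    then have "\<lceil>x $ i - 1/2\<rceil> = z"
      unfolding z by (intro ceiling_unique) auto
    then show ?thesis using z by simp
  qed
  then show "m = (\<chi> i. of_int \<lceil>x $ i - 1/2\<rceil>)"
    by (simp add: vec_eq_iff)
qed

lemma norm_torus_le: "x \<in> torus \<Longrightarrow> norm (x :: real ^ 'd) \<le> CARD('d)"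
proof -
  assume x: "x \<in> torus"
  have "norm x \<le> (\<Sum>i\<in>UNIV. \<bar>x $ i\<bar>)" by (rule norm_le_l1_cart)
  also have "\<dots> \<le> (\<Sum>i\<in>(UNIV :: 'd set). 1)"
  proof (intro sum_mono)
    fix i
    have "- 1/2 < x $ i" "x $ i \<le> 1/2" using x by (auto simp: torus_def)
    then show "\<bar>x $ i\<bar> \<le> 1" by linarith
  qed
  finally show ?thesis by simp
qed

lemma borel_torus [measurable]: "(torus :: (real ^ 'd) set) \<in> sets borel"
proof -
  have "torus = (\<Inter>i. {x :: real ^ 'd. - 1/2 < x $ i} \<inter> {x. x $ i \<le> 1/2})"
    by (auto simp: torus_def)
  also have "\<dots> \<in> sets borel"
    by (intro sets.countable_INT'' sets.Int borel_open borel_closed open_Collect_less closed_Collect_le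
        continuous_intros) auto
  finally show ?thesis .
qed

lemma emeasure_torus: "emeasure lborel (torus :: (real ^ 'd) set) = 1"
proof (rule antisym)
  let ?l = "(\<chi> i. - 1/2) :: real ^ 'd" and ?u = "(\<chi> i. 1/2) :: real ^ 'd"
  have sub: "box ?l ?u \<subseteq> torus" "torus \<subseteq> cbox ?l ?u"
    by (auto simp: torus_def mem_box_cart less_imp_le)
  have le: "?l \<bullet> b \<le> ?u \<bullet> b" if "b \<in> Basis" for b
    using that by (auto simp: Basis_vec_def inner_axis)
  have prod: "(\<Prod>b\<in>Basis. (?u - ?l) \<bullet> b) = 1"
    by (intro prod.neutral) (auto simp: Basis_vec_def inner_axis)
  show "emeasure lborel (torus :: (real ^ 'd) set) \<le> 1"
    using emeasure_mono[OF sub(2), of lborel] prod le by (simp add: emeasure_lborel_cbox_eq)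
  show "1 \<le> emeasure lborel (torus :: (real ^ 'd) set)"
    using emeasure_mono[OF sub(1), of lborel] prod le by (simp add: emeasure_lborel_box_eq)
qed

section \<open>Integrals over the torus as integrals over Euclidean space\<close>

abbreviation torus_measure :: "(real ^ 'd) measure" where
  "torus_measure \<equiv> lebesgue_on torus"

lemma finite_measure_torus: "finite_measure (torus_measure :: (real ^ 'd) measure)"
  by (intro finite_measureI) (simp add: emeasure_restrict_space emeasure_torus)

lemma measure_torus [simp]: "measure (torus_measure :: (real ^ 'd) measure) torus = 1"
  by (simp add: measure_def emeasure_restrict_space emeasure_torus)

lemma borel_measurable_torus:
  "f \<in> borel_measurable borel \<Longrightarrow> f \<in> borel_measurable (torus_measure :: (real ^ 'd) measure)"
  by (intro measurable_restrict_space1 measurable_completion) simp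

text \<open>Translations are applied under \<open>lborel\<close>, whereas the torus carries the
  completed measure; for Borel functions the completion changes neither integrability nor the
  value.\<close>

lemma has_bochner_integral_torus:
  fixes f :: "real ^ 'd \<Rightarrow> 'b :: {banach, second_countable_topology}"
  assumes "f \<in> borel_measurable borel"
  shows "has_bochner_integral torus_measure f I \<longleftrightarrow>
    has_bochner_integral lborel (\<lambda>x. indicator torus x *\<^sub>R f x) I"
proof -
  have "(\<lambda>x. indicator torus x *\<^sub>R f x) \<in> borel_measurable lborel"
    using assms by measurable
  then show ?thesis
    using assms by (auto simp: has_bochner_integral_iff integrable_restrict_space
        integral_restrict_space integrable_completion integral_completion)
qed

lemma has_bochner_integral_lborel_plus:
  fixes f :: "'a::euclidean_space \<Rightarrow> 'b :: {banach, second_countable_topology}"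
  assumes "has_bochner_integral lborel f I"
  shows "has_bochner_integral lborel (\<lambda>x. f (x + c)) I"
proof -
  have "has_bochner_integral (distr lborel borel ((+) c)) f I"
    using assms by (simp add: lborel_distr_plus)
  then have "has_bochner_integral lborel (\<lambda>x. f (c + x)) I"
    using borel_measurable_has_bochner_integral[OF assms]
    by (auto simp: has_bochner_integral_iff integrable_distr_eq integral_distr)
  then show ?thesis by (simp add: add.commute)
qed

text \<open>Only finitely many translates of a compactly supported function meet the torus; \<open>L\<close> has to
  contain all of them.\<close>

lemma torus_unfold:
  fixes F :: "real ^ 'd \<Rightarrow> 'b :: {banach, second_countable_topology}"
  assumes int: "has_bochner_integral lborel F I"
    and L: "finite L" "L \<subseteq> int_lattice"
    and cover: "\<And>x k. F x \<noteq> 0 \<Longrightarrow> k \<in> int_lattice \<Longrightarrow> x - k \<in> torus \<Longrightarrow> k \<in> L"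
  shows "has_bochner_integral torus_measure (\<lambda>x. \<Sum>k\<in>L. F (x + k)) I"
proof -
  have F [measurable]: "F \<in> borel_measurable borel"
    using borel_measurable_has_bochner_integral[OF int] by simp
  \<comment> \<open>\<open>F\<close> is cut along the lattice translates of the cube; translation by
    \<open>k\<close> moves the piece \<open>G k\<close> back onto the torus.\<close>
  define G where "G k x = (indicator torus (x - k) :: real) *\<^sub>R F x" for k x
  have G [measurable]: "G k \<in> borel_measurable borel" for k
    unfolding G_def by measurable
  have intG: "integrable lborel (G k)" for k
    by (rule Bochner_Integration.integrable_bound[of lborel F])
      (use int in \<open>auto simp: G_def indicator_def has_bochner_integral_iff\<close>)
  have "has_bochner_integral lborel (\<lambda>x. indicator torus x *\<^sub>R F (x + k)) (integral\<^sup>L lborel (G k))" for k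
    using has_bochner_integral_lborel_plus[OF has_bochner_integral_integrable[OF intG], of k k]
    by (simp add: G_def)
  then have "has_bochner_integral lborel (\<lambda>x. \<Sum>k\<in>L. indicator torus x *\<^sub>R F (x + k))
      (\<Sum>k\<in>L. integral\<^sup>L lborel (G k))"
    by (intro has_bochner_integral_sum)
  moreover have "(\<Sum>k\<in>L. integral\<^sup>L lborel (G k)) = integral\<^sup>L lborel (\<lambda>x. \<Sum>k\<in>L. G k x)"
    using intG by (simp add: Bochner_Integration.integral_sum)
  moreover have "(\<Sum>k\<in>L. G k x) = F x" for x
  proof (cases "F x = 0")
    case False
    obtain k where k: "k \<in> int_lattice" "x - k \<in> torus"
      and uniq: "\<And>j. j \<in> int_lattice \<Longrightarrow> x - j \<in> torus \<Longrightarrow> j = k"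
      using torus_tile[of x] by auto
    have "k \<in> L" using cover False k by blast
    then have "(\<Sum>j\<in>L. G j x) = (\<Sum>j\<in>{k}. G j x)"
      using L uniq by (intro sum.mono_neutral_right) (auto simp: G_def indicator_def)
    then show ?thesis using k by (simp add: G_def)
  qed (simp add: G_def)
  ultimately show ?thesis
    using int by (subst has_bochner_integral_torus)
      (auto simp: scaleR_sum_right has_bochner_integral_iff intro!: borel_measurable_sum)
qed

text \<open>The summand \<open>CARD('d)\<close> is a crude bound for the norm of a point of the
  torus. With it the set contains every lattice point whose translate of the cube meets the closed
  ball of radius \<open>r\<close>, which is what \<open>torus_unfold\<close> asks of
  \<open>L\<close>.\<close>

definition lattice_ball :: "real \<Rightarrow> (real ^ 'd) set" where
  "lattice_ball r = {m \<in> int_lattice. norm m \<le> r + CARD('d)}"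

lemma lattice_ball: "finite (lattice_ball r)" "lattice_ball r \<subseteq> int_lattice"
  using finite_int_lattice_le by (auto simp: lattice_ball_def)

lemma lattice_ball_cover:
  assumes "norm x \<le> r" "k \<in> int_lattice" "x - k \<in> torus"
  shows "k \<in> lattice_ball r"
proof -
  have "norm k \<le> norm x + norm (x - k)"
    by (metis add.commute diff_add_cancel norm_triangle_sub norm_minus_commute)
  then show ?thesis
    using assms norm_torus_le[of "x - k"] by (simp add: lattice_ball_def)
qed

text \<open>Translation by h with m h = 1/2 multiplies the character by -1, and the integral over a
  period is invariant under translation, so I = - I.\<close>

lemma character_orthogonal:
  assumes "m \<in> int_lattice" "m \<noteq> (0 :: real ^ 'd)"
  shows "has_bochner_integral torus_measure (character m) 0"
proof -
  define h where "h = (1 / (2 * (m \<bullet> m))) *\<^sub>R m"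
  have h: "character m h = - 1"
    using assms by (simp add: character_def h_def)
  define F where "F x = (indicator torus x :: real) *\<^sub>R character m x" for x
  define I where "I = integral\<^sup>L lborel F"
  have "integrable lborel F"
    unfolding F_def
    by (rule Bochner_Integration.integrable_bound[of lborel "indicator (torus :: (real ^ 'd) set) :: _ \<Rightarrow> real"])
      (auto simp: emeasure_torus)
  then have F: "has_bochner_integral lborel F I"
    by (simp add: I_def has_bochner_integral_iff)
  have "has_bochner_integral lborel (\<lambda>x. - F (x + - h)) (- I)"
    by (intro has_bochner_integral_minus has_bochner_integral_lborel_plus F)
  moreover have neg: "- F (x + - h) = (indicator torus (x - h) :: real) *\<^sub>R character m x" for x
  proof -
    have "character m x = character m (x - h) * character m h"
      by (simp flip: character_add_right)
    then show ?thesis by (simp add: F_def h)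
  qed
  ultimately have "has_bochner_integral torus_measure
      (\<lambda>x. \<Sum>k\<in>lattice_ball (CARD('d) + norm h). - F (x + k + - h)) (- I)"
  proof (intro torus_unfold lattice_ball)
    fix x k assume "- F (x + - h) \<noteq> 0" "k \<in> int_lattice" "x - k \<in> torus"
    then show "k \<in> lattice_ball (CARD('d) + norm h)"
      using norm_torus_le[of "x - h"] norm_triangle_sub[of x h]
      by (intro lattice_ball_cover[of x]) (auto simp: F_def indicator_def split: if_splits)
  qed
  also have "has_bochner_integral torus_measure
        (\<lambda>x. \<Sum>k\<in>lattice_ball (CARD('d) + norm h). - F (x + k + - h)) (- I) \<longleftrightarrow>
      has_bochner_integral torus_measure (character m) (- I)"
  proof (intro has_bochner_integral_cong refl)
    fix x :: "real ^ 'd" assume "x \<in> space torus_measure"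
    then have x: "x \<in> torus" by simp
    obtain k where k: "k \<in> int_lattice" and kt: "x + k - h \<in> torus"
      and uniq: "\<And>j. j \<in> int_lattice \<Longrightarrow> (x - h) + j \<in> torus \<Longrightarrow> j = k"
    proof -
      from torus_tile[of "x - h"] obtain k where k: "k \<in> int_lattice" "x - h - k \<in> torus"
        and uniq: "\<And>j. j \<in> int_lattice \<Longrightarrow> x - h - j \<in> torus \<Longrightarrow> j = k" by auto
      show ?thesis
      proof (rule that[of "- k"])
        show "- k \<in> int_lattice" using k int_lattice_minus by blast
        show "x + - k - h \<in> torus" using k by (simp add: algebra_simps)
        show "j = - k" if "j \<in> int_lattice" "x - h + j \<in> torus" for j
          using uniq[of "- j"] that int_lattice_minus[of j] by (auto simp: minus_equation_iff)
      qed
    qed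
    have "norm k \<le> norm (x + k - h) + norm x + norm h"
      using norm_triangle_ineq4[of "x + k - h" "x - h"] norm_triangle_ineq4[of x h] by simp
    then have "k \<in> lattice_ball (CARD('d) + norm h)"
      using k norm_torus_le[OF x] norm_torus_le[OF kt] by (simp add: lattice_ball_def)
    \<comment> \<open>Exactly one lattice translate of x - h falls into the cube, so a single term
      survives.\<close>
    then have "(\<Sum>j\<in>lattice_ball (CARD('d) + norm h). - F (x + j + - h)) = (\<Sum>j\<in>{k}. - F (x + j + - h))"
      using uniq lattice_ball(2)
      by (intro sum.mono_neutral_right lattice_ball) (auto simp: F_def indicator_def algebra_simps)
    also have "\<dots> = character m x"
      using kt neg[of "x + k"] character_shift[OF assms(1) k] by simp
    finally show "(\<Sum>j\<in>lattice_ball (CARD('d) + norm h). - F (x + j + - h)) = character m x" .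
  qed
  finally have 1: "has_bochner_integral torus_measure (character m) (- I)" .
  have "has_bochner_integral torus_measure (character m) I"
    using F by (subst has_bochner_integral_torus) (auto simp: F_def[abs_def])
  with 1 have "I = - I"
    using has_bochner_integral_eq by blast
  then show ?thesis using 1 by simp
qed

section \<open>Square integrable functions and the Bessel inequality\<close>

definition trig_poly :: "(real ^ 'd) set \<Rightarrow> (real ^ 'd \<Rightarrow> complex) \<Rightarrow> real ^ 'd \<Rightarrow> complex" where
  "trig_poly F p x = (\<Sum>m\<in>F. p m * character m x)"

lemma fourier_coeff_eq:
  fixes f :: "real ^ 'd \<Rightarrow> complex"
  shows "fourier_coeff f m = (LINT x|torus_measure. f x * cnj (character m x))"
proof -
  have "exp (- 2 * of_real pi * \<i> * of_real (m \<bullet> x)) = cnj (character m x)" for x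
    unfolding character_def cis_conv_exp by (simp add: exp_cnj algebra_simps)
  then show ?thesis by (simp add: fourier_coeff_def)
qed

lemma spherical_sum_eq:
  "spherical_sum r f = trig_poly {m \<in> int_lattice. norm m < r} (fourier_coeff f)"
  by (simp add: spherical_sum_def trig_poly_def character_def cis_conv_exp mult_ac fun_eq_iff)

lemma borel_measurable_character_torus [measurable]: "character m \<in> borel_measurable torus_measure"
  by (intro borel_measurable_torus) simp

lemma borel_measurable_trig_poly [measurable]: "trig_poly F p \<in> borel_measurable borel"
  unfolding trig_poly_def by measurable

lemma norm_trig_poly_le: "norm (trig_poly F p x) \<le> (\<Sum>m\<in>F. norm (p m))"
  unfolding trig_poly_def by (rule sum_norm_le) (simp add: norm_mult)

lemma character_inner:
  assumes "m \<in> int_lattice" "n \<in> int_lattice"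
  shows "has_bochner_integral torus_measure (\<lambda>x. character m x * cnj (character n x))
    (if m = n then 1 else 0)"
proof (cases "m = n")
  case True
  have "has_bochner_integral torus_measure (\<lambda>x :: real ^ 'd. 1 :: complex) 1"
    using finite_measure.integrable_const[OF finite_measure_torus, of "1 :: complex"]
    by (simp add: has_bochner_integral_iff)
  with True show ?thesis
    by (simp add: complex_norm_square[symmetric])
next
  case False
  have "character m x * cnj (character n x) = character (m - n) x" for x
    unfolding diff_conv_add_uminus character_add character_minus ..
  then show ?thesis
    using character_orthogonal[of "m - n"] int_lattice_diff[OF assms] False by simp
qed

section \<open>Mean square distance to trigonometric polynomials\<close>

locale square_integrable =
  fixes f :: "real ^ 'd \<Rightarrow> complex"
  assumes meas [measurable]: "f \<in> borel_measurable torus_measure"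
    and int2: "integrable torus_measure (\<lambda>x. (norm (f x))\<^sup>2)"
begin

lemma integrable_f: "integrable torus_measure f"
proof (rule Bochner_Integration.integrable_bound[OF _ meas])
  show "integrable torus_measure (\<lambda>x. 1 + (norm (f x))\<^sup>2)"
    using finite_measure.integrable_const[OF finite_measure_torus, of "1 :: real"] int2
    by (intro Bochner_Integration.integrable_add)
  have "t \<le> 1 + t\<^sup>2" for t :: real
    using zero_le_power2[of "t - 1/2"] by (simp add: power2_eq_square algebra_simps)
  then show "AE x in torus_measure. norm (f x) \<le> norm (1 + (norm (f x))\<^sup>2)"
    by simp
qed

lemma integral_mult_trig_poly:
  assumes "finite F"
  shows "has_bochner_integral torus_measure (\<lambda>x. f x * cnj (trig_poly F p x))
    (\<Sum>m\<in>F. cnj (p m) * fourier_coeff f m)"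
proof -
  have "has_bochner_integral torus_measure (\<lambda>x. cnj (p m) * (f x * cnj (character m x)))
      (cnj (p m) * fourier_coeff f m)" for m
    unfolding fourier_coeff_eq
  proof (intro has_bochner_integral_mult_right has_bochner_integral_integrable)
    show "integrable torus_measure (\<lambda>x. f x * cnj (character m x))"
      by (rule Bochner_Integration.integrable_bound[OF integrable_f])
        (auto simp: norm_mult simp flip: character_minus)
  qed
  then have "has_bochner_integral torus_measure (\<lambda>x. \<Sum>m\<in>F. cnj (p m) * (f x * cnj (character m x)))
    (\<Sum>m\<in>F. cnj (p m) * fourier_coeff f m)"
    by (rule has_bochner_integral_sum)
  then show ?thesis
    by (simp add: trig_poly_def sum_distrib_left mult_ac)
qed

end

lemma square_integrable_bounded:
  assumes "f \<in> borel_measurable (torus_measure :: (real ^ 'd) measure)" "\<And>x. norm (f x) \<le> B"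
  shows "square_integrable f"
proof
  show "integrable torus_measure (\<lambda>x. (norm (f x))\<^sup>2)"
    by (rule finite_measure.integrable_const_bound[OF finite_measure_torus, of _ "B\<^sup>2"])
      (use assms in \<open>auto intro!: power_mono\<close>)
qed fact

lemma square_integrable_trig_poly: "square_integrable (trig_poly F p)"
  by (rule square_integrable_bounded[OF borel_measurable_torus[OF borel_measurable_trig_poly]
        norm_trig_poly_le])

lemma square_integrable_diff:
  assumes "square_integrable f" "square_integrable g"
  shows "square_integrable (\<lambda>x. f x - g x)"
proof
  interpret f: square_integrable f by fact
  interpret g: square_integrable g by fact
  show [measurable]: "(\<lambda>x. f x - g x) \<in> borel_measurable torus_measure" by measurable
  show "integrable torus_measure (\<lambda>x. (norm (f x - g x))\<^sup>2)"
  proof (rule Bochner_Integration.integrable_bound)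
    show "integrable torus_measure (\<lambda>x. 2 * (norm (f x))\<^sup>2 + 2 * (norm (g x))\<^sup>2)"
      using f.int2 g.int2 by simp
    have "(norm (f x - g x))\<^sup>2 \<le> 2 * (norm (f x))\<^sup>2 + 2 * (norm (g x))\<^sup>2" for x
    proof -
      have "(norm (f x - g x))\<^sup>2 \<le> (norm (f x) + norm (g x))\<^sup>2"
        by (intro power_mono norm_triangle_ineq4) simp
      also have "\<dots> \<le> 2 * (norm (f x))\<^sup>2 + 2 * (norm (g x))\<^sup>2"
        using zero_le_power2[of "norm (f x) - norm (g x)"] by (simp add: power2_eq_square algebra_simps)
      finally show ?thesis .
    qed
    then show "AE x in torus_measure. norm ((norm (f x - g x))\<^sup>2)
        \<le> norm (2 * (norm (f x))\<^sup>2 + 2 * (norm (g x))\<^sup>2)"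
      by simp
  qed measurable
qed

lemma fourier_coeff_trig_poly:
  assumes "finite F" "F \<subseteq> int_lattice" "n \<in> int_lattice"
  shows "fourier_coeff (trig_poly F p) n = (if n \<in> F then p n else 0)"
proof -
  have "has_bochner_integral torus_measure (\<lambda>x. \<Sum>m\<in>F. p m * (character m x * cnj (character n x)))
      (\<Sum>m\<in>F. p m * (if m = n then 1 else 0))"
    using assms by (intro has_bochner_integral_sum has_bochner_integral_mult_right character_inner) auto
  moreover have "(\<Sum>m\<in>F. p m * (if m = n then 1 else 0)) = (if n \<in> F then p n else 0)"
    using assms(1) by (simp add: if_distrib cong: if_cong)
  ultimately show ?thesis
    by (simp add: fourier_coeff_eq trig_poly_def has_bochner_integral_iff sum_distrib_right mult.assoc)
qed

text \<open>Completing the square: the cross terms see \<open>f\<close> only through its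
  coefficients. Taking \<open>p\<close> to be the coefficients of \<open>f\<close> gives Bessel's
  inequality, taking \<open>f\<close> to be the polynomial itself gives its norm, and the
  nonnegative last sum shows that Fourier sums are the best approximations with frequencies in
  \<open>F\<close>.\<close>

lemma integral_norm2_diff_trig_poly:
  assumes f: "square_integrable f" and F: "finite F" "F \<subseteq> int_lattice"
  shows "(LINT x|torus_measure. (norm (f x - trig_poly F p x))\<^sup>2) =
    (LINT x|torus_measure. (norm (f x))\<^sup>2) - (\<Sum>m\<in>F. (norm (fourier_coeff f m))\<^sup>2)
      + (\<Sum>m\<in>F. (norm (fourier_coeff f m - p m))\<^sup>2)"
proof -
  interpret f: square_integrable f by fact
  let ?P = "trig_poly F p"
  interpret P: square_integrable ?P by (rule square_integrable_trig_poly)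
  interpret D: square_integrable "\<lambda>x. f x - ?P x"
    by (intro square_integrable_diff f square_integrable_trig_poly)
  let ?c = "fourier_coeff f"
  have norm2: "complex_of_real ((norm z)\<^sup>2) = z * cnj z" for z
    by (rule complex_norm_square)
  have ff: "has_bochner_integral torus_measure (\<lambda>x. f x * cnj (f x))
      (complex_of_real (LINT x|torus_measure. (norm (f x))\<^sup>2))"
    unfolding norm2[symmetric]
    by (intro has_bochner_integral_of_real has_bochner_integral_integrable f.int2)
  note fP = f.integral_mult_trig_poly[OF F(1), of p]
  have Pf: "has_bochner_integral torus_measure (\<lambda>x. ?P x * cnj (f x)) (\<Sum>m\<in>F. p m * cnj (?c m))"
    using has_bochner_integral_cnj[OF fP] by (simp add: mult_ac)
  have PP: "has_bochner_integral torus_measure (\<lambda>x. ?P x * cnj (?P x)) (\<Sum>m\<in>F. cnj (p m) * p m)"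
  proof -
    have "(\<Sum>m\<in>F. cnj (p m) * fourier_coeff ?P m) = (\<Sum>m\<in>F. cnj (p m) * p m)"
    proof (intro sum.cong refl)
      fix m assume "m \<in> F"
      then show "cnj (p m) * fourier_coeff ?P m = cnj (p m) * p m"
        using fourier_coeff_trig_poly[OF F, of m p] subsetD[OF F(2)] by simp
    qed
    then show ?thesis using P.integral_mult_trig_poly[OF F(1), of p] by simp
  qed
  have "has_bochner_integral torus_measure
      (\<lambda>x. (f x * cnj (f x) - f x * cnj (?P x)) - (?P x * cnj (f x) - ?P x * cnj (?P x)))
      ((of_real (LINT x|torus_measure. (norm (f x))\<^sup>2) - (\<Sum>m\<in>F. cnj (p m) * ?c m))
        - ((\<Sum>m\<in>F. p m * cnj (?c m)) - (\<Sum>m\<in>F. cnj (p m) * p m)))"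
    by (intro has_bochner_integral_diff ff fP Pf PP)
  also have "(\<lambda>x. (f x * cnj (f x) - f x * cnj (?P x)) - (?P x * cnj (f x) - ?P x * cnj (?P x)))
      = (\<lambda>x. complex_of_real ((norm (f x - ?P x))\<^sup>2))"
    unfolding norm2 by (simp add: algebra_simps)
  finally have "complex_of_real (LINT x|torus_measure. (norm (f x - ?P x))\<^sup>2) =
      (of_real (LINT x|torus_measure. (norm (f x))\<^sup>2) - (\<Sum>m\<in>F. cnj (p m) * ?c m))
        - ((\<Sum>m\<in>F. p m * cnj (?c m)) - (\<Sum>m\<in>F. cnj (p m) * p m))"
    by (rule has_bochner_integral_eq[OF
          has_bochner_integral_of_real[OF has_bochner_integral_integrable[OF D.int2]]])
  also have "\<dots> = of_real (LINT x|torus_measure. (norm (f x))\<^sup>2)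
      + (\<Sum>m\<in>F. - (cnj (p m) * ?c m) - p m * cnj (?c m) + cnj (p m) * p m)"
    by (simp add: sum.distrib sum_subtractf sum_negf)
  also have "(\<Sum>m\<in>F. - (cnj (p m) * ?c m) - p m * cnj (?c m) + cnj (p m) * p m)
      = (\<Sum>m\<in>F. complex_of_real ((norm (?c m - p m))\<^sup>2 - (norm (?c m))\<^sup>2))"
    unfolding of_real_diff norm2 complex_cnj_diff by (intro sum.cong refl) algebra
  finally have "complex_of_real (LINT x|torus_measure. (norm (f x - ?P x))\<^sup>2) =
      complex_of_real ((LINT x|torus_measure. (norm (f x))\<^sup>2) 
        + (\<Sum>m\<in>F. (norm (?c m - p m))\<^sup>2 - (norm (?c m))\<^sup>2))"
    by (simp del: of_real_power)
  then have "(LINT x|torus_measure. (norm (f x - ?P x))\<^sup>2) =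
      (LINT x|torus_measure. (norm (f x))\<^sup>2) + (\<Sum>m\<in>F. (norm (?c m - p m))\<^sup>2 - (norm (?c m))\<^sup>2)"
    by (simp only: of_real_eq_iff)
  then show ?thesis by (simp add: sum_subtractf)
qed

lemma bessel_inequality:
  assumes "square_integrable f" "finite F" "F \<subseteq> int_lattice"
  shows "(\<Sum>m\<in>F. (norm (fourier_coeff f m))\<^sup>2) \<le> (LINT x|torus_measure. (norm (f x))\<^sup>2)"
proof -
  have "0 \<le> (LINT x|torus_measure. (norm (f x - trig_poly F (fourier_coeff f) x))\<^sup>2)" by simp
  then show ?thesis
    by (subst (asm) integral_norm2_diff_trig_poly) (use assms in auto)
qed

lemma integral_norm2_trig_poly:
  assumes "finite F" "F \<subseteq> int_lattice"
  shows "(LINT x|torus_measure. (norm (trig_poly F p x))\<^sup>2) = (\<Sum>m\<in>F. (norm (p m))\<^sup>2)"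
proof -
  have "square_integrable (trig_poly F p)" by (rule square_integrable_trig_poly)
  from integral_norm2_diff_trig_poly[OF this assms, of p] assms
  show ?thesis
    by (simp add: fourier_coeff_trig_poly subset_iff)
qed

section \<open>Density of trigonometric polynomials\<close>

text \<open>Quantifying away frequencies and coefficients gives a class closed under sums and
  products, as the induction over real polynomials below needs.\<close>

definition trig_function :: "(real ^ 'd \<Rightarrow> complex) \<Rightarrow> bool" where
  "trig_function g \<longleftrightarrow> (\<exists>F p. finite F \<and> F \<subseteq> int_lattice \<and> g = trig_poly F p)"

lemma trig_function_character: "m \<in> int_lattice \<Longrightarrow> trig_function (character m)"
  unfolding trig_function_def
  by (intro exI[of _ "{m}"] exI[of _ "\<lambda>_. 1"]) (simp add: trig_poly_def fun_eq_iff)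

lemma trig_function_cmult:
  assumes "trig_function g"
  shows "trig_function (\<lambda>x. c * g x)"
proof -
  from assms obtain F p where "finite F" "F \<subseteq> int_lattice" "g = trig_poly F p"
    by (auto simp: trig_function_def)
  then show ?thesis
    unfolding trig_function_def
    by (intro exI[of _ F] exI[of _ "\<lambda>m. c * p m"])
      (simp add: trig_poly_def fun_eq_iff sum_distrib_left mult.assoc)
qed

lemma trig_function_const: "trig_function (\<lambda>x. c)"
  using trig_function_cmult[OF trig_function_character[OF int_lattice_0], of c] by simp

lemma trig_function_add:
  assumes "trig_function f" "trig_function g"
  shows "trig_function (\<lambda>x. f x + g x)"
proof -
  from assms obtain F p G q where F: "finite F" "F \<subseteq> int_lattice" "f = trig_poly F p"
    and G: "finite G" "G \<subseteq> int_lattice" "g = trig_poly G q"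
    by (auto simp: trig_function_def)
  define r where "r m = (if m \<in> F then p m else 0) + (if m \<in> G then q m else 0)" for m
  have "f x + g x = trig_poly (F \<union> G) r x" for x
  proof -
    have "f x = (\<Sum>m\<in>F \<union> G. (if m \<in> F then p m else 0) * character m x)"
      unfolding F(3) trig_poly_def using F G by (intro sum.mono_neutral_cong_left) auto
    moreover have "g x = (\<Sum>m\<in>F \<union> G. (if m \<in> G then q m else 0) * character m x)"
      unfolding G(3) trig_poly_def using F G by (intro sum.mono_neutral_cong_left) auto
    ultimately show ?thesis
      by (simp add: trig_poly_def r_def distrib_right sum.distrib)
  qed
  then show ?thesis
    unfolding trig_function_def using F G
    by (intro exI[of _ "F \<union> G"] exI[of _ r]) auto
qed

lemma trig_function_sum:
  "finite A \<Longrightarrow> (\<And>i. i \<in> A \<Longrightarrow> trig_function (f i)) \<Longrightarrow> trig_function (\<lambda>x. \<Sum>i\<in>A. f i x)"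
  by (induction A rule: finite_induct) (auto intro: trig_function_add trig_function_const)

lemma trig_function_mult:
  assumes "trig_function f" "trig_function g"
  shows "trig_function (\<lambda>x. f x * g x)"
proof -
  from assms obtain F p G q where F: "finite F" "F \<subseteq> int_lattice" "f = trig_poly F p"
    and G: "finite G" "G \<subseteq> int_lattice" "g = trig_poly G q"
    by (auto simp: trig_function_def)
  have eq: "(\<lambda>x. f x * g x) = (\<lambda>x. \<Sum>m\<in>F. \<Sum>n\<in>G. (p m * q n) * character (m + n) x)"
    by (simp add: F(3) G(3) trig_poly_def sum_product character_add mult_ac)
  show ?thesis
    unfolding eq using F G
    by (intro trig_function_sum trig_function_cmult trig_function_character int_lattice_add) auto
qed

section \<open>Uniform approximation by Stone-Weierstrass on a product of circles\<close>

text \<open>The quotient map of the torus, realised as a product of unit circles.\<close>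

definition torus_map :: "real ^ 'd \<Rightarrow> complex ^ 'd" where
  "torus_map x = (\<chi> i. cis (2 * pi * x $ i))"

lemma continuous_torus_map: "continuous_on A torus_map"
  unfolding torus_map_def by (intro continuous_intros continuous_on_vec_lambda)

text \<open>A real linear functional is a combination of real and imaginary parts of coordinates. On
  the image of the torus these are (z + cnj z) / 2 and (z - cnj z) / (2 i), where z and cnj z are
  the characters of a unit vector and its negative.\<close>

lemma trig_function_real_polynomial_torus_map:
  assumes "real_polynomial_function g"
  shows "trig_function (\<lambda>x :: real ^ 'd. complex_of_real (g (torus_map x)))"
  using assms
proof induction
  case (linear f)
  interpret bounded_linear f by fact
  have *: "complex_of_real (f (torus_map x)) = (\<Sum>i\<in>UNIV.
      (of_real (f (axis i 1)) / 2) * (character (axis i 1) x + character (- axis i 1) x)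
       + (of_real (f (axis i \<i>)) / (2 * \<i>)) * (character (axis i 1) x + (-1) * character (- axis i 1) x))"
    for x :: "real ^ 'd"
  proof -
    have "torus_map x = (\<Sum>i\<in>UNIV. Re (torus_map x $ i) *\<^sub>R axis i 1 + Im (torus_map x $ i) *\<^sub>R axis i \<i>)"
      (is "_ = ?rhs")
    proof (subst vec_eq_iff, rule allI)
      fix j
      have "?rhs $ j = (\<Sum>i\<in>UNIV. if i = j then torus_map x $ j else 0)"
        unfolding sum_component
        by (intro sum.cong) (auto simp: axis_def complex_eq_iff)
      then show "torus_map x $ j = ?rhs $ j" by simp
    qed
    then have "f (torus_map x) = f ?rhs" by (rule arg_cong)
    also have "\<dots> = (\<Sum>i\<in>UNIV. Re (torus_map x $ i) * f (axis i 1) + Im (torus_map x $ i) * f (axis i \<i>))"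
      by (simp add: sum add scale)
    finally have f: "f (torus_map x) = \<dots>" .
    show ?thesis
      unfolding f of_real_sum
    proof (intro sum.cong refl)
      fix i
      have ch: "character (axis i 1) x = torus_map x $ i" "character (- axis i 1) x = cnj (torus_map x $ i)"
        unfolding character_minus by (auto simp: character_def torus_map_def inner_axis')
      show "complex_of_real (Re (torus_map x $ i) * f (axis i 1) + Im (torus_map x $ i) * f (axis i \<i>)) =
        (of_real (f (axis i 1)) / 2) * (character (axis i 1) x + character (- axis i 1) x)
         + (of_real (f (axis i \<i>)) / (2 * \<i>)) * (character (axis i 1) x + (-1) * character (- axis i 1) x)"
        unfolding ch by (simp add: complex_eq_iff)
    qed
  qed
  have axis: "axis i 1 \<in> int_lattice" "- axis i 1 \<in> int_lattice" for i :: 'd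
    by (auto simp: int_lattice_def axis_def)
  show ?case
    unfolding * by (intro trig_function_sum trig_function_add trig_function_cmult
        trig_function_character axis) auto
next
  case (add f g)
  then show ?case using trig_function_add by fastforce
next
  case (mult f g)
  then show ?case using trig_function_mult by fastforce
qed (rule trig_function_const)

abbreviation closed_torus :: "(real ^ 'd) set" where
  "closed_torus \<equiv> cbox (\<chi> i. - 1/2) (\<chi> i. 1/2)"

abbreviation open_torus :: "(real ^ 'd) set" where
  "open_torus \<equiv> box (\<chi> i. - 1/2) (\<chi> i. 1/2)"

lemma open_torus_subset: "open_torus \<subseteq> torus" and torus_subset: "torus \<subseteq> closed_torus"
  by (auto simp: torus_def mem_box_cart less_imp_le)

text \<open>Opposite faces of the closed cube have the same image, so one of the points must be
  interior. Equal images force coordinates to differ by an integer, which then has modulus below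
  1.\<close>

lemma torus_map_inj:
  assumes "x \<in> open_torus" "y \<in> closed_torus" "torus_map x = torus_map y"
  shows "x = y"
proof -
  have "x $ i = y $ i" for i
  proof -
    have "cis (2 * pi * x $ i) = cis (2 * pi * y $ i)"
      using assms(3) by (simp add: torus_map_def vec_eq_iff)
    then have "cis (2 * pi * x $ i - 2 * pi * y $ i) = 1"
      by (simp add: cis_divide[symmetric])
    then obtain n :: int where n: "2 * pi * x $ i - 2 * pi * y $ i = 2 * pi * n"
      by (auto simp: cis_conv_exp exp_eq_1)
    then have "2 * pi * (x $ i - y $ i) = 2 * pi * n" by (simp add: algebra_simps)
    then have "x $ i - y $ i = n" by simp
    moreover have "\<bar>x $ i - y $ i\<bar> < 1"
      using assms(1,2) by (auto simp: mem_box_cart abs_less_iff less_imp_le field_simps) (smt (verit))+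
    ultimately have "\<bar>real_of_int n\<bar> < 1" and n': "x $ i - y $ i = n" by simp_all
    then have "n = 0" by linarith
    with n' show ?thesis by simp
  qed
  then show ?thesis by (simp add: vec_eq_iff)
qed

text \<open>Vanishing on the boundary of the cube makes \<open>g\<close> compatible with the gluing
  of opposite faces, so it descends to a continuous function on a compact set of tuples of unit
  complex numbers.\<close>

lemma trig_poly_uniform_approx:
  fixes g :: "real ^ 'd \<Rightarrow> real"
  assumes cont: "continuous_on closed_torus g" and zero: "\<And>x. x \<in> closed_torus - open_torus \<Longrightarrow> g x = 0"
    and e: "e > 0"
  obtains F p where "finite F" "F \<subseteq> int_lattice"
    "\<And>x. x \<in> torus \<Longrightarrow> norm (complex_of_real (g x) - trig_poly F p x) < e"
proof -
  let ?S = "torus_map ` (closed_torus :: (real ^ 'd) set)"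
  have well: "g x = g y" if "x \<in> closed_torus" "y \<in> closed_torus" "torus_map x = torus_map y" for x y
    using torus_map_inj[of x y] torus_map_inj[of y x] zero[of x] zero[of y] that
    by (cases "x \<in> open_torus"; cases "y \<in> open_torus") auto
  define G where "G z = g (SOME x. x \<in> closed_torus \<and> torus_map x = z)" for z
  have G: "G (torus_map x) = g x" if "x \<in> closed_torus" for x
  proof -
    have "(SOME y. y \<in> closed_torus \<and> torus_map y = torus_map x) \<in> closed_torus \<and>
        torus_map (SOME y. y \<in> closed_torus \<and> torus_map y = torus_map x) = torus_map x"
      by (rule someI[of _ x]) (use that in simp)
    then show ?thesis unfolding G_def using well that by blast
  qed
  have comp: "compact (closed_torus :: (real ^ 'd) set)" by (rule compact_cbox)
  \<comment> \<open>Continuity descends by compactness: the preimage of a closed set under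
    \<open>G\<close> is the image of a compact set under \<open>torus_map\<close>.\<close>
  have contG: "continuous_on ?S G"
    unfolding continuous_closedin_preimage_eq
  proof (intro allI impI)
    fix T :: "real set" assume T: "closed T"
    have "compact (closed_torus \<inter> g -` T)"
      using continuous_closed_preimage[OF cont closed_cbox T] bounded_cbox
      by (auto simp: compact_eq_bounded_closed)
    then have "compact (torus_map ` (closed_torus \<inter> g -` T))"
      by (intro compact_continuous_image continuous_torus_map)
    moreover have "torus_map ` (closed_torus \<inter> g -` T) = ?S \<inter> G -` T"
      using G by auto
    ultimately show "closedin (top_of_set ?S) (?S \<inter> G -` T)"
      by (intro closed_subset) (auto dest: compact_imp_closed)
  qed
  obtain q where q: "real_polynomial_function q" "\<And>z. z \<in> ?S \<Longrightarrow> \<bar>G z - q z\<bar> < e"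
    using Stone_Weierstrass_real_polynomial_function[OF compact_continuous_image[OF
        continuous_torus_map comp] contG e] by blast
  obtain F p where F: "finite F" "F \<subseteq> int_lattice"
    and p: "(\<lambda>x. complex_of_real (q (torus_map x))) = trig_poly F p"
    using trig_function_real_polynomial_torus_map[OF q(1)] by (auto simp: trig_function_def)
  show thesis
  proof (rule that[OF F])
    fix x :: "real ^ 'd" assume "x \<in> torus"
    then have x: "x \<in> closed_torus" using torus_subset by blast
    have "complex_of_real (g x) - trig_poly F p x = complex_of_real (g x - q (torus_map x))"
      by (simp flip: p)
    then have "norm (complex_of_real (g x) - trig_poly F p x) = \<bar>g x - q (torus_map x)\<bar>"
      by (simp only: norm_of_real)
    then show "norm (complex_of_real (g x) - trig_poly F p x) < e"
      using q(2)[of "torus_map x"] G[OF x] x by auto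
  qed
qed

section \<open>Mean square approximation, from continuous to square integrable functions\<close>

definition trig_approximable :: "(real ^ 'd \<Rightarrow> complex) \<Rightarrow> bool" where
  "trig_approximable f \<longleftrightarrow> (\<forall>e>0. \<exists>g. trig_function g \<and>
     (LINT x|torus_measure. (norm (f x - g x))\<^sup>2) < e)"

lemma square_integrable_trig_function: "trig_function g \<Longrightarrow> square_integrable g"
  by (auto simp: trig_function_def square_integrable_trig_poly)

lemma trig_approximable_limit:
  assumes f: "square_integrable f" and g: "\<And>n :: nat. square_integrable (g n)"
    and approx: "\<And>n. trig_approximable (g n)"
    and lim: "(\<lambda>n. LINT x|torus_measure. (norm (f x - g n x))\<^sup>2) \<longlonglongrightarrow> 0"
  shows "trig_approximable f"
  unfolding trig_approximable_def
proof (intro allI impI)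
  fix e :: real assume e: "e > 0"
  \<comment> \<open>Since |v + w|^2 \<le> 2 |v|^2 + 2 |w|^2, two squared errors below e / 4 combine
    to one below e.\<close>
  have "eventually (\<lambda>n. (LINT x|torus_measure. (norm (f x - g n x))\<^sup>2) < e / 4) sequentially"
    by (rule order_tendstoD[OF lim]) (use e in simp)
  then obtain n where n: "(LINT x|torus_measure. (norm (f x - g n x))\<^sup>2) < e / 4"
    by (auto simp: eventually_sequentially)
  obtain h where h: "trig_function h" "(LINT x|torus_measure. (norm (g n x - h x))\<^sup>2) < e / 4"
    using approx[of n] e unfolding trig_approximable_def
    by (meson divide_pos_pos zero_less_numeral)
  interpret fg: square_integrable "\<lambda>x. f x - g n x" by (rule square_integrable_diff[OF f g])
  interpret gh: square_integrable "\<lambda>x. g n x - h x"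
    by (rule square_integrable_diff[OF g square_integrable_trig_function[OF h(1)]])
  interpret fh: square_integrable "\<lambda>x. f x - h x"
    by (rule square_integrable_diff[OF f square_integrable_trig_function[OF h(1)]])
  have "(LINT x|torus_measure. (norm (f x - h x))\<^sup>2)
      \<le> (LINT x|torus_measure. 2 * (norm (f x - g n x))\<^sup>2 + 2 * (norm (g n x - h x))\<^sup>2)"
  proof (intro integral_mono fh.int2 Bochner_Integration.integrable_add
      Bochner_Integration.integrable_mult_right fg.int2 gh.int2)
    fix x
    have "(norm (f x - h x))\<^sup>2 \<le> (norm (f x - g n x) + norm (g n x - h x))\<^sup>2"
      using norm_triangle_ineq[of "f x - g n x" "g n x - h x"] by (intro power_mono) auto
    also have "\<dots> \<le> 2 * (norm (f x - g n x))\<^sup>2 + 2 * (norm (g n x - h x))\<^sup>2"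
      using zero_le_power2[of "norm (f x - g n x) - norm (g n x - h x)"]
      by (simp add: power2_eq_square algebra_simps)
    finally show "(norm (f x - h x))\<^sup>2 \<le> 2 * (norm (f x - g n x))\<^sup>2 + 2 * (norm (g n x - h x))\<^sup>2" .
  qed
  also have "\<dots> = 2 * (LINT x|torus_measure. (norm (f x - g n x))\<^sup>2)
      + 2 * (LINT x|torus_measure. (norm (g n x - h x))\<^sup>2)"
    using fg.int2 gh.int2 by simp
  also have "\<dots> < e" using n h(2) by simp
  finally show "\<exists>g. trig_function g \<and> (LINT x|torus_measure. (norm (f x - g x))\<^sup>2) < e"
    using h(1) by blast
qed

lemma trig_approximable_dominated_limit:
  fixes f :: "real ^ 'd \<Rightarrow> complex"
  assumes f: "square_integrable f" and g: "\<And>n :: nat. square_integrable (g n)"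
    and approx: "\<And>n. trig_approximable (g n)"
    and lim: "AE x in torus_measure. (\<lambda>n. g n x) \<longlonglongrightarrow> f x"
    and w: "integrable torus_measure w" "\<And>n x. (norm (f x - g n x))\<^sup>2 \<le> w x"
  shows "trig_approximable f"
proof (rule trig_approximable_limit[OF f g approx])
  have fg: "square_integrable (\<lambda>x. f x - g n x)" for n by (rule square_integrable_diff[OF f g])
  have "(\<lambda>n. LINT x|torus_measure. (norm (f x - g n x))\<^sup>2) \<longlonglongrightarrow> (LINT x|(torus_measure :: (real ^ 'd) measure). 0)"
  proof (rule integral_dominated_convergence[where w = w])
    show "integrable torus_measure w" by fact
    show "AE x in torus_measure. (\<lambda>n. (norm (f x - g n x))\<^sup>2) \<longlonglongrightarrow> 0"
      using lim
    proof eventually_elim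
      case (elim x)
      have "(\<lambda>n. (norm (f x - g n x))\<^sup>2) \<longlonglongrightarrow> (norm (f x - f x))\<^sup>2"
        by (intro tendsto_intros elim)
      then show ?case by simp
    qed
    show "AE x in torus_measure. norm ((norm (f x - g n x))\<^sup>2) \<le> w x" for n
      using w(2) by simp
    show "(\<lambda>x. (norm (f x - g n x))\<^sup>2) \<in> borel_measurable torus_measure" for n
      using square_integrable.int2[OF fg] by (rule borel_measurable_integrable)
  qed simp
  then show "(\<lambda>n. LINT x|torus_measure. (norm (f x - g n x))\<^sup>2) \<longlonglongrightarrow> 0" by simp
qed

lemma continuous_imp_trig_approximable:
  fixes g :: "real ^ 'd \<Rightarrow> real"
  assumes "continuous_on closed_torus g" "\<And>x. x \<in> closed_torus - open_torus \<Longrightarrow> g x = 0"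
  shows "trig_approximable (\<lambda>x. complex_of_real (g x))"
  unfolding trig_approximable_def
proof (intro allI impI)
  fix e :: real assume e: "e > 0"
  obtain F p where F: "finite F" "F \<subseteq> int_lattice"
    and close: "\<And>x. x \<in> torus \<Longrightarrow> norm (complex_of_real (g x) - trig_poly F p x) < sqrt (e / 2)"
    using trig_poly_uniform_approx[OF assms, of "sqrt (e / 2)"] e by auto
  have "(LINT x|torus_measure. (norm (complex_of_real (g x) - trig_poly F p x))\<^sup>2)
      \<le> (LINT x|(torus_measure :: (real ^ 'd) measure). e / 2)"
  proof (rule integral_mono')
    show "integrable torus_measure (\<lambda>x :: real ^ 'd. e / 2)"
      by (rule finite_measure.integrable_const[OF finite_measure_torus])
    fix x :: "real ^ 'd" assume "x \<in> space torus_measure"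
    then have "(norm (complex_of_real (g x) - trig_poly F p x))\<^sup>2 \<le> (sqrt (e / 2))\<^sup>2"
      using close[of x] by (intro power_mono) auto
    then show "(norm (complex_of_real (g x) - trig_poly F p x))\<^sup>2 \<le> e / 2"
      using e by simp
  qed (use e in simp)
  also have "\<dots> < e" using e by simp
  finally show "\<exists>h. trig_function h \<and> (LINT x|torus_measure. (norm (complex_of_real (g x) - h x))\<^sup>2) < e"
    using F unfolding trig_function_def by blast
qed

definition clip :: "real \<Rightarrow> real \<Rightarrow> real" where
  "clip B t = max (- B) (min B t)"

lemma abs_clip_le: "B \<ge> 0 \<Longrightarrow> \<bar>clip B t\<bar> \<le> B"
  by (auto simp: clip_def)

lemma clip_id: "\<bar>t\<bar> \<le> B \<Longrightarrow> clip B t = t"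
  by (auto simp: clip_def)

lemma abs_diff_clip_le: "B \<ge> 0 \<Longrightarrow> \<bar>t - clip B t\<bar> \<le> \<bar>t\<bar>"
  by (auto simp: clip_def max_def min_def)

lemma continuous_on_clip [continuous_intros]:
  "continuous_on A f \<Longrightarrow> continuous_on A (\<lambda>x. clip B (f x))"
  unfolding clip_def by (intro continuous_intros)

lemma tendsto_clip [tendsto_intros]:
  "(f \<longlongrightarrow> l) F \<Longrightarrow> ((\<lambda>x. clip B (f x)) \<longlongrightarrow> clip B l) F"
  unfolding clip_def by (intro tendsto_intros)

lemma borel_measurable_clip [measurable]:
  "f \<in> borel_measurable M \<Longrightarrow> (\<lambda>x. clip B (f x)) \<in> borel_measurable M"
  unfolding clip_def by (intro borel_measurable_max borel_measurable_min borel_measurable_const)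

lemma AE_torus_open: "AE x in torus_measure. x \<in> (open_torus :: (real ^ 'd) set)"
proof -
  have "closed_torus - open_torus \<in> null_sets (lebesgue :: (real ^ 'd) measure)"
    using negligible_frontier_interval negligible_iff_null_sets by blast
  then have "AE x in lebesgue. x \<notin> closed_torus - (open_torus :: (real ^ 'd) set)"
    by (rule AE_not_in)
  then have "AE x in lebesgue. x \<in> torus \<longrightarrow> x \<in> (open_torus :: (real ^ 'd) set)"
    by eventually_elim (use torus_subset in blast)
  then show ?thesis by (subst AE_restrict_space_iff) auto
qed

text \<open>A measurable function is an almost everywhere limit of continuous ones. These have to be
  modified to stay dominated and to vanish on the boundary of the cube.\<close>

lemma bounded_imp_trig_approximable:
  fixes f :: "real ^ 'd \<Rightarrow> real"
  assumes meas: "f \<in> borel_measurable torus_measure" and B: "\<And>x. \<bar>f x\<bar> \<le> B"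
  shows "trig_approximable (\<lambda>x. complex_of_real (f x))"
proof -
  have B0: "B \<ge> 0" using B[of 0] by linarith
  have "f measurable_on torus"
    using meas by (subst measurable_on_iff_borel_measurable) auto
  then obtain N g where N: "negligible N" and cont: "\<And>n. continuous_on UNIV (g n)"
    and lim: "\<And>x. x \<notin> N \<Longrightarrow> (\<lambda>n. g n x) \<longlonglongrightarrow> (if x \<in> torus then f x else 0)"
    by (auto simp: measurable_on_def)
  \<comment> \<open>The cutoff vanishes off the open cube and equals 1 at each interior point for
    all large \<open>n\<close>, so it does not disturb the limit; clipping at \<open>B\<close>
    supplies the domination.\<close>
  define \<psi> where "\<psi> n x = min 1 (real n * infdist x (- open_torus))" for n and x :: "real ^ 'd"
  define h where "h n x = clip B (g n x) * \<psi> n x" for n x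
  have ne: "- (open_torus :: (real ^ 'd) set) \<noteq> {}"
    using bounded_box[of "(\<chi> i. - 1/2) :: real ^ 'd"] not_bounded_UNIV by (metis Compl_empty_eq double_complement)
  have \<psi>: "0 \<le> \<psi> n x" "\<psi> n x \<le> 1" for n x
    by (auto simp: \<psi>_def infdist_nonneg)
  have cont_h: "continuous_on A (h n)" for n A
    unfolding h_def \<psi>_def
    by (intro continuous_intros continuous_on_subset[OF cont]) auto
  have h_le: "\<bar>h n x\<bar> \<le> B" for n x
    using mult_mono[OF abs_clip_le[OF B0] \<psi>(2)] \<psi> B0 by (simp add: h_def abs_mult)
  show ?thesis
  proof (rule trig_approximable_dominated_limit[where g = "\<lambda>n x. complex_of_real (h n x)"])
    show "square_integrable (\<lambda>x. complex_of_real (f x))"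
      using meas B by (intro square_integrable_bounded[of _ B]) auto
    show "square_integrable (\<lambda>x. complex_of_real (h n x))" for n
      using h_le cont_h
      by (intro square_integrable_bounded[of _ B] borel_measurable_torus
          borel_measurable_continuous_onI continuous_intros) auto
    show "trig_approximable (\<lambda>x. complex_of_real (h n x))" for n
      by (intro continuous_imp_trig_approximable cont_h) (auto simp: h_def \<psi>_def)
    have "AE x in lebesgue. x \<notin> N"
      using N by (intro AE_not_in) (simp add: negligible_iff_null_sets)
    then have "AE x in torus_measure. x \<notin> N"
      by (subst AE_restrict_space_iff) auto
    with AE_torus_open show "AE x in torus_measure. (\<lambda>n. complex_of_real (h n x)) \<longlonglongrightarrow> complex_of_real (f x)"
    proof eventually_elim
      case (elim x)
      then have "x \<in> torus" using open_torus_subset by blast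
      with lim elim have g: "(\<lambda>n. g n x) \<longlonglongrightarrow> f x" by fastforce
      have "infdist x (- open_torus) > 0"
        using elim ne by (intro infdist_pos_not_in_closed) (auto simp: closed_def)
      then obtain n0 :: nat where n0: "1 < real n0 * infdist x (- open_torus)"
        using reals_Archimedean3 by blast
      have "eventually (\<lambda>n. real n * infdist x (- open_torus) \<ge> 1) sequentially"
        using eventually_ge_at_top[of n0]
      proof eventually_elim
        case (elim n)
        then have "real n0 * infdist x (- open_torus) \<le> real n * infdist x (- open_torus)"
          by (intro mult_right_mono) (auto simp: infdist_nonneg)
        then show ?case using n0 by linarith
      qed
      then have "eventually (\<lambda>n. \<psi> n x = 1) sequentially"
        by eventually_elim (simp add: \<psi>_def)
      then have "(\<lambda>n. \<psi> n x) \<longlonglongrightarrow> 1" by (rule tendsto_eventually)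
      with g have "(\<lambda>n. h n x) \<longlonglongrightarrow> clip B (f x) * 1"
        unfolding h_def by (intro tendsto_intros)
      then show ?case
        using clip_id[OF B] by (intro tendsto_of_real) simp
    qed
    show "integrable torus_measure (\<lambda>x :: real ^ 'd. (2 * B)\<^sup>2)"
      by (rule finite_measure.integrable_const[OF finite_measure_torus])
    show "(norm (complex_of_real (f x) - complex_of_real (h n x)))\<^sup>2 \<le> (2 * B)\<^sup>2" for n x
    proof (rule power_mono)
      show "norm (complex_of_real (f x) - complex_of_real (h n x)) \<le> 2 * B"
        using norm_triangle_ineq4[of "complex_of_real (f x)" "complex_of_real (h n x)"] B[of x] h_le[of n x]
        by simp
    qed simp
  qed
qed

text \<open>Clipping the values at height \<open>n\<close> gives bounded functions, and |f|^2
  dominates all the squared errors.\<close>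

lemma trig_approximable_real:
  fixes f :: "real ^ 'd \<Rightarrow> real"
  assumes f: "square_integrable (\<lambda>x. complex_of_real (f x))"
  shows "trig_approximable (\<lambda>x. complex_of_real (f x))"
proof -
  interpret square_integrable "\<lambda>x. complex_of_real (f x)" by fact
  have "(\<lambda>x. Re (complex_of_real (f x))) \<in> borel_measurable torus_measure"
    using meas by measurable
  then have [measurable]: "f \<in> borel_measurable torus_measure" by simp
  show ?thesis
  proof (rule trig_approximable_dominated_limit[OF f])
    show "square_integrable (\<lambda>x. complex_of_real (clip (real n) (f x)))" for n
      by (intro square_integrable_bounded[of _ "real n"]) (auto simp: abs_clip_le)
    show "trig_approximable (\<lambda>x. complex_of_real (clip (real n) (f x)))" for n
      by (intro bounded_imp_trig_approximable[of _ "real n"]) (auto simp: abs_clip_le)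
    have "(\<lambda>n. complex_of_real (clip (real n) (f x))) \<longlonglongrightarrow> complex_of_real (f x)" for x
    proof (rule tendsto_eventually)
      obtain N :: nat where N: "\<bar>f x\<bar> \<le> real N" using real_arch_simple by blast
      show "eventually (\<lambda>n. complex_of_real (clip (real n) (f x)) = complex_of_real (f x)) sequentially"
        using eventually_ge_at_top[of N]
      proof eventually_elim
        case (elim n)
        then have "\<bar>f x\<bar> \<le> real n" using N by linarith
        then show ?case by (simp add: clip_id)
      qed
    qed
    then show "AE x in torus_measure. (\<lambda>n. complex_of_real (clip (real n) (f x))) \<longlonglongrightarrow> complex_of_real (f x)"
      by simp
    show "integrable torus_measure (\<lambda>x. (norm (complex_of_real (f x)))\<^sup>2)" by (rule int2)
    show "(norm (complex_of_real (f x) - complex_of_real (clip (real n) (f x))))\<^sup>2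
        \<le> (norm (complex_of_real (f x)))\<^sup>2" for n x
      using abs_diff_clip_le[of "real n" "f x"]
      by (intro power_mono) (simp_all flip: of_real_diff)
  qed
qed

section \<open>Almost everywhere convergence of orthogonal series\<close>

text \<open>The sum of |block sum|^2 over all nodes of the binary tree of dyadic subintervals of
  \<open>{s..<s + 2 ^ k}\<close>. It bounds all initial segments simultaneously and is thus a
  majorant for a maximal function.\<close>

fun dyadic_energy :: "(nat \<Rightarrow> complex) \<Rightarrow> nat \<Rightarrow> nat \<Rightarrow> real" where
  "dyadic_energy z 0 s = (norm (z s))\<^sup>2"
| "dyadic_energy z (Suc k) s = (norm (\<Sum>n\<in>{s..<s + 2 ^ Suc k}. z n))\<^sup>2
     + dyadic_energy z k s + dyadic_energy z k (s + 2 ^ k)"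

lemma dyadic_energy_nonneg: "dyadic_energy z k s \<ge> 0"
  by (induction z k s rule: dyadic_energy.induct) auto

lemma norm_sum_le_dyadic_energy: "(norm (\<Sum>n\<in>{s..<s + 2 ^ k}. z n))\<^sup>2 \<le> dyadic_energy z k s"
  by (cases k) (auto simp: dyadic_energy_nonneg intro!: add_nonneg_nonneg)

text \<open>Equality holds for b = c a. Used with c = k + 1, it lets the constant in the induction
  over tree levels grow by one per level instead of doubling.\<close>

lemma power2_add_le_weighted:
  fixes a b c :: real
  assumes "c > 0"
  shows "(a + b)\<^sup>2 \<le> (1 + c) * (a\<^sup>2 + b\<^sup>2 / c)"
proof -
  have "0 \<le> (c * a - b)\<^sup>2 / c" using assms by simp
  also have "(c * a - b)\<^sup>2 / c = (1 + c) * (a\<^sup>2 + b\<^sup>2 / c) - (a + b)\<^sup>2"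
    using assms by (simp add: field_simps power2_eq_square)
  finally show ?thesis by simp
qed

text \<open>A segment longer than half the interval is the full left half followed by an initial
  segment of the right half. It therefore uses at most one node per level, whence the factor k +
  1.\<close>

lemma norm_partial_sum_le_dyadic_energy:
  "N \<le> 2 ^ k \<Longrightarrow> (norm (\<Sum>n\<in>{s..<s + N}. z n))\<^sup>2 \<le> (real k + 1) * dyadic_energy z k s"
proof (induction k arbitrary: s N)
  case 0
  then have "N = 0 \<or> N = 1" by auto
  then show ?case by auto
next
  case (Suc k)
  show ?case
  proof (cases "N \<le> 2 ^ k")
    case True
    have "(norm (\<Sum>n\<in>{s..<s + N}. z n))\<^sup>2 \<le> (real k + 1) * dyadic_energy z k s"
      using Suc.IH True by blast
    also have "\<dots> \<le> (real (Suc k) + 1) * dyadic_energy z (Suc k) s"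
      by (intro mult_mono) (auto simp: dyadic_energy_nonneg)
    finally show ?thesis .
  next
    case False
    define M where "M = N - 2 ^ k"
    define A B where "A = (\<Sum>n\<in>{s..<s + 2 ^ k}. z n)"
      and "B = (\<Sum>n\<in>{s + 2 ^ k..<s + 2 ^ k + M}. z n)"
    have "(\<Sum>n\<in>{s..<s + N}. z n) = A + B"
      unfolding A_def B_def using False
      by (subst sum.atLeastLessThan_concat) (auto simp: M_def)
    then have "(norm (\<Sum>n\<in>{s..<s + N}. z n))\<^sup>2 \<le> (norm A + norm B)\<^sup>2"
      by (simp add: norm_triangle_ineq power_mono)
    also have "\<dots> \<le> (1 + (real k + 1)) * ((norm A)\<^sup>2 + (norm B)\<^sup>2 / (real k + 1))"
      by (rule power2_add_le_weighted) simp
    also have "\<dots> \<le> (1 + (real k + 1)) * (dyadic_energy z k s + dyadic_energy z k (s + 2 ^ k))"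
    proof (intro mult_left_mono add_mono)
      show "(norm A)\<^sup>2 \<le> dyadic_energy z k s"
        unfolding A_def by (rule norm_sum_le_dyadic_energy)
      have "(norm B)\<^sup>2 \<le> (real k + 1) * dyadic_energy z k (s + 2 ^ k)"
        unfolding B_def using Suc.prems by (intro Suc.IH) (auto simp: M_def)
      then show "(norm B)\<^sup>2 / (real k + 1) \<le> dyadic_energy z k (s + 2 ^ k)"
        by (simp add: field_simps)
    qed auto
    also have "\<dots> \<le> (real (Suc k) + 1) * dyadic_energy z (Suc k) s"
      by (intro mult_mono) (auto simp: dyadic_energy_nonneg)
    finally show ?thesis .
  qed
qed

text \<open>Each of the k + 1 levels of the tree partitions the same index interval and contributes
  at most the total of \<open>b\<close>. Orthogonality enters through the hypothesis on every
  interval of indices.\<close>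

lemma integral_dyadic_energy_le:
  fixes P :: "nat \<Rightarrow> 'a \<Rightarrow> complex"
  assumes int: "\<And>i j. integrable M (\<lambda>x. (norm (\<Sum>n\<in>{i..<j}. P n x))\<^sup>2)"
    and le: "\<And>i j. (\<integral>x. (norm (\<Sum>n\<in>{i..<j}. P n x))\<^sup>2 \<partial>M) \<le> (\<Sum>n\<in>{i..<j}. b n)"
  shows "integrable M (\<lambda>x. dyadic_energy (\<lambda>n. P n x) k s) \<and>
    (\<integral>x. dyadic_energy (\<lambda>n. P n x) k s \<partial>M) \<le> (real k + 1) * (\<Sum>n\<in>{s..<s + 2 ^ k}. b n)"
proof (induction k arbitrary: s)
  case 0
  show ?case using int[of s "Suc s"] le[of s "Suc s"] by simp
next
  case (Suc k)
  let ?B = "\<lambda>i j. \<Sum>n\<in>{i..<j}. b n"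
  have B: "?B s (s + 2 ^ k) + ?B (s + 2 ^ k) (s + 2 ^ k + 2 ^ k) = ?B s (s + 2 ^ Suc k)"
    by (subst sum.atLeastLessThan_concat) (auto simp: mult_2 add.assoc)
  have "(\<integral>x. dyadic_energy (\<lambda>n. P n x) (Suc k) s \<partial>M) \<le> ?B s (s + 2 ^ Suc k)
      + (real k + 1) * ?B s (s + 2 ^ k) + (real k + 1) * ?B (s + 2 ^ k) (s + 2 ^ k + 2 ^ k)"
    using Suc[of s] Suc[of "s + 2 ^ k"] int[of s "s + 2 ^ Suc k"] le[of s "s + 2 ^ Suc k"]
    by simp
  also have "\<dots> = (real (Suc k) + 1) * ?B s (s + 2 ^ Suc k)"
    unfolding B[symmetric] by (simp add: distrib_left distrib_right)
  finally show ?case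
    using Suc int[of s "s + 2 ^ Suc k"] by simp
qed

section \<open>Almost everywhere convergence from geometric decay of the blocks\<close>

text \<open>The pointwise sum of the series has finite integral by monotone convergence, so it is
  finite almost everywhere.\<close>

lemma AE_summable:
  fixes g :: "nat \<Rightarrow> 'a \<Rightarrow> real"
  assumes int: "\<And>k. integrable M (g k)" and nonneg: "\<And>k x. g k x \<ge> 0"
    and le: "\<And>k. integral\<^sup>L M (g k) \<le> c k" and c: "summable c"
  shows "AE x in M. summable (\<lambda>k. g k x)"
proof -
  have [measurable]: "g k \<in> borel_measurable M" for k
    using int by (rule borel_measurable_integrable)
  have c0: "0 \<le> c k" for k
    using order_trans[OF Bochner_Integration.integral_nonneg le[of k]] nonneg by simp
  have "(\<integral>\<^sup>+x. (\<Sum>k. ennreal (g k x)) \<partial>M) = (\<Sum>k. \<integral>\<^sup>+x. ennreal (g k x) \<partial>M)"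
    by (intro nn_integral_suminf) simp
  also have "\<dots> = (\<Sum>k. ennreal (integral\<^sup>L M (g k)))"
    using int nonneg by (simp add: nn_integral_eq_integral)
  also have "\<dots> \<le> (\<Sum>k. ennreal (c k))"
    by (intro suminf_le ennreal_leI le) auto
  also have "\<dots> = ennreal (suminf c)"
    using c c0 by (simp add: suminf_ennreal_eq sums_iff)
  finally have "(\<integral>\<^sup>+x. (\<Sum>k. ennreal (g k x)) \<partial>M) \<noteq> \<infinity>"
    by (auto simp: top_unique)
  then have "AE x in M. (\<Sum>k. ennreal (g k x)) \<noteq> \<infinity>"
    by (intro nn_integral_PInf_AE) simp_all
  then show ?thesis
    by eventually_elim (use nonneg in \<open>auto intro: summable_suminf_not_top\<close>)
qed

text \<open>A weak form of the Rademacher--Menshov theorem: geometric decay of the mean squares of the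
  dyadic blocks replaces the sharp logarithmic weights.\<close>

lemma AE_convergent_dyadic_blocks:
  fixes P :: "nat \<Rightarrow> 'a \<Rightarrow> complex"
  assumes int: "\<And>i j. integrable M (\<lambda>x. (norm (\<Sum>n\<in>{i..<j}. P n x))\<^sup>2)"
    and le: "\<And>i j. (\<integral>x. (norm (\<Sum>n\<in>{i..<j}. P n x))\<^sup>2 \<partial>M) \<le> (\<Sum>n\<in>{i..<j}. b n)"
    and blocks: "\<And>k. k \<ge> K \<Longrightarrow> (\<Sum>n\<in>{2 ^ k..<2 ^ Suc k}. b n) \<le> C * \<rho> ^ k"
    and \<rho>: "0 < \<rho>" "\<rho> < 1"
  shows "AE x in M. convergent (\<lambda>N. \<Sum>n<N. P n x)"
proof -
  \<comment> \<open>Half of the decay rate is set aside: after division by \<open>\<tau> ^ k\<close>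
    the integrals are still summable, and the gain pays for passing from \<open>E\<close> to its
    square root.\<close>
  define \<tau> where "\<tau> = sqrt \<rho>"
  have \<tau>: "0 < \<tau>" "\<tau> < 1" "\<tau>\<^sup>2 = \<rho>" using \<rho> by (auto simp: \<tau>_def)
  \<comment> \<open>A pointwise majorant for the squared oscillation of the partial sums over the
    indices from 2^k to 2^(k+1). The index 0 lies in no block, which does not affect
    convergence.\<close>
  define E where "E k x = (real k + 1) * dyadic_energy (\<lambda>n. P n x) k (2 ^ k)" for k x
  define B where "B k = (\<Sum>n\<in>{2 ^ k..<2 ^ Suc k}. b n)" for k
  have E0: "E k x \<ge> 0" for k x
    by (simp add: E_def dyadic_energy_nonneg)
  have Eint: "integrable M (\<lambda>x. E k x / \<tau> ^ k)" for k
    using integral_dyadic_energy_le[of M P b, OF int le] by (simp add: E_def)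
  have Ele: "(\<integral>x. E k x / \<tau> ^ k \<partial>M) \<le> (real k + 1)\<^sup>2 * B k / \<tau> ^ k" for k
  proof -
    have "(\<integral>x. dyadic_energy (\<lambda>n. P n x) k (2 ^ k) \<partial>M) \<le> (real k + 1) * B k"
      using integral_dyadic_energy_le[of M P b k "2 ^ k", OF int le] by (simp add: B_def mult_2)
    then have "(real k + 1) * (\<integral>x. dyadic_energy (\<lambda>n. P n x) k (2 ^ k) \<partial>M) / \<tau> ^ k
        \<le> (real k + 1) * ((real k + 1) * B k) / \<tau> ^ k"
      using \<tau> by (intro divide_right_mono mult_left_mono) auto
    then show ?thesis by (simp add: E_def power2_eq_square mult.assoc)
  qed
  have B0: "B k \<ge> 0" for k
    using order_trans[OF _ le] by (simp add: B_def)
  have "summable (\<lambda>k. (real k + 1)\<^sup>2 * B k / \<tau> ^ k)"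
  proof (rule summable_comparison_test_ev)
    have "eventually (\<lambda>k. (real k + 1)\<^sup>2 * B k / \<tau> ^ k \<le> C * ((real k + 1)\<^sup>2 * \<tau> ^ k)) sequentially"
      using eventually_ge_at_top[of K]
    proof eventually_elim
      case (elim k)
      have "\<tau> ^ k * \<tau> ^ k = \<rho> ^ k"
        unfolding \<tau>(3)[symmetric] by (simp add: power2_eq_square power_mult_distrib)
      moreover have "(real k + 1)\<^sup>2 * B k \<le> (real k + 1)\<^sup>2 * (C * \<rho> ^ k)"
        using blocks[OF elim] by (intro mult_left_mono) (auto simp: B_def)
      ultimately show ?case
        using \<tau> by (simp add: field_simps)
    qed
    then show "eventually (\<lambda>k. norm ((real k + 1)\<^sup>2 * B k / \<tau> ^ k) \<le> C * ((real k + 1)\<^sup>2 * \<tau> ^ k)) sequentially"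
      using B0 \<tau> by simp
    have "summable (\<lambda>k. (real k + 1)\<^sup>2 * \<tau> ^ k)"
    proof (rule summable_comparison_test')
      \<comment> \<open>(k + 1)^2 \<tau>^k is the square of (k + 1) y^k. One factor is bounded by
        the sum of the differentiated geometric series, and the other keeps the product
        summable.\<close>
      define y where "y = sqrt \<tau>"
      have y: "0 \<le> y" "y < 1" "y\<^sup>2 = \<tau>" using \<tau> by (auto simp: y_def)
      have sums: "(\<lambda>k. real (Suc k) * y ^ k) sums (1 / (1 - y)\<^sup>2)"
        using y by (intro geometric_deriv_sums) auto
      then show "summable (\<lambda>k. 1 / (1 - y)\<^sup>2 * (real (Suc k) * y ^ k))"
        by (intro summable_mult) (rule sums_summable)
      show "norm ((real k + 1)\<^sup>2 * \<tau> ^ k) \<le> 1 / (1 - y)\<^sup>2 * (real (Suc k) * y ^ k)" for k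
      proof -
        have "real (Suc k) * y ^ k \<le> 1 / (1 - y)\<^sup>2"
          using sum_le_suminf[of "\<lambda>k. real (Suc k) * y ^ k" "{k}"] sums y by (auto simp: sums_iff)
        then have "(real (Suc k) * y ^ k) * (real (Suc k) * y ^ k) \<le> 1 / (1 - y)\<^sup>2 * (real (Suc k) * y ^ k)"
          using y by (intro mult_right_mono) auto
        moreover have "\<tau> ^ k = y ^ k * y ^ k"
          unfolding y(3)[symmetric] by (simp add: power2_eq_square power_mult_distrib)
        ultimately show ?thesis
          using \<tau> y by (simp add: abs_mult power2_eq_square mult_ac add.commute)
      qed
    qed
    then show "summable (\<lambda>k. C * ((real k + 1)\<^sup>2 * \<tau> ^ k))" by (rule summable_mult)
  qed
  then have "AE x in M. summable (\<lambda>k. E k x / \<tau> ^ k)"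
    by (intro AE_summable[OF Eint _ Ele]) (use E0 \<tau> in auto)
  then show ?thesis
  proof eventually_elim
    case (elim x)
    define S where "S N = (\<Sum>n<N. P n x)" for N
    define G where "G k = sqrt (E k x)" for k
    have GG: "(G k)\<^sup>2 = E k x" "G k \<ge> 0" for k
      using E0 by (auto simp: G_def)
    have block: "norm (S N - S (2 ^ k)) \<le> G k" if "2 ^ k \<le> N" "N \<le> 2 ^ Suc k" for N k
    proof -
      have "S N - S (2 ^ k) = (\<Sum>n\<in>{2 ^ k..<N}. P n x)"
        using that(1) by (simp add: S_def lessThan_atLeast0 sum_diff_nat_ivl)
      also have "{2 ^ k..<N} = {2 ^ k..<2 ^ k + (N - 2 ^ k)}" using that by simp
      finally have "(norm (S N - S (2 ^ k)))\<^sup>2 \<le> E k x"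
        using norm_partial_sum_le_dyadic_energy[of "N - 2 ^ k" k "\<lambda>n. P n x" "2 ^ k"] that
        by (simp add: E_def)
      then show ?thesis by (simp add: G_def real_le_rsqrt)
    qed
    have "summable G"
    proof (rule summable_comparison_test')
      show "summable (\<lambda>k. \<tau> ^ k + E k x / \<tau> ^ k)"
        using elim \<tau> by (intro summable_add summable_geometric) auto
      \<comment> \<open>Either G k \<le> \<tau>^k, or G k > \<tau>^k and then G k \<le> (G k)^2 /
        \<tau>^k.\<close>
      show "norm (G k) \<le> \<tau> ^ k + E k x / \<tau> ^ k" for k
      proof (cases "G k \<le> \<tau> ^ k")
        case True
        then show ?thesis using GG(2)[of k] E0[of k x] \<tau>
          by (auto intro: add_increasing2)
      next
        case False
        have "G k * \<tau> ^ k \<le> G k * G k"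
          using False GG(2)[of k] by (intro mult_left_mono) auto
        then have "G k \<le> E k x / \<tau> ^ k"
          using \<tau> by (simp add: field_simps power2_eq_square flip: GG(1))
        then show ?thesis using GG(2)[of k] \<tau>
          by (auto intro: add_increasing)
      qed
    qed
    have "Cauchy S"
    proof (rule metric_CauchyI)
      fix e :: real assume e: "e > 0"
      obtain K where K: "\<And>n. (\<Sum>k\<in>{K..<n}. G k) < e / 2"
      proof -
        from \<open>summable G\<close>[unfolded summable_Cauchy] e
        obtain K where "\<And>m n. m \<ge> K \<Longrightarrow> norm (sum G {m..<n}) < e / 2" 
          by (metis half_gt_zero)
        then show ?thesis using that[of K] by (metis abs_ge_self le_less_trans order_refl real_norm_def)
      qed
      \<comment> \<open>Between powers of two the increments telescope over full blocks; reaching an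
        arbitrary index costs one more, partial, block.\<close>
      have dyad: "norm (S (2 ^ (K + j)) - S (2 ^ K)) \<le> (\<Sum>k\<in>{K..<K + j}. G k)" for j
      proof (induction j)
        case (Suc j)
        have "norm (S (2 ^ (K + Suc j)) - S (2 ^ K))
            \<le> norm (S (2 ^ (K + Suc j)) - S (2 ^ (K + j))) + norm (S (2 ^ (K + j)) - S (2 ^ K))"
          using norm_triangle_ineq[of "S (2 ^ (K + Suc j)) - S (2 ^ (K + j))" "S (2 ^ (K + j)) - S (2 ^ K)"] by simp
        also have "\<dots> \<le> G (K + j) + (\<Sum>k\<in>{K..<K + j}. G k)"
          using Suc by (intro add_mono block) auto
        finally show ?case by simp
      qed simp
      have near: "norm (S N - S (2 ^ K)) < e / 2" if N: "N \<ge> 2 ^ K" for N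
      proof -
        have "N \<ge> 1" using N order_trans[of 1 "2 ^ K" N] by simp
        then obtain l where l: "2 ^ l \<le> N" "N < 2 ^ Suc l"
          using ex_power_ivl1[of 2 N] by auto
        have "2 ^ K < (2 ^ Suc l :: nat)" using l N by linarith
        then have "K < Suc l" by (rule power_less_imp_less_exp[rotated]) simp
        then obtain j where j: "l = K + j" by (metis less_Suc_eq_le le_iff_add)
        have "2 ^ (K + j) \<le> N" "N \<le> 2 ^ Suc (K + j)"
          using l j by auto
        then have "norm (S N - S (2 ^ K)) \<le> G (K + j) + (\<Sum>k\<in>{K..<K + j}. G k)"
          using norm_triangle_ineq[of "S N - S (2 ^ (K + j))" "S (2 ^ (K + j)) - S (2 ^ K)"]
            block[of "K + j" N] dyad[of j] by simp
        then show ?thesis using K[of "K + Suc j"] by simp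
      qed
      show "\<exists>M. \<forall>m\<ge>M. \<forall>n\<ge>M. dist (S m) (S n) < e"
      proof (intro exI allI impI)
        fix m n :: nat assume "m \<ge> 2 ^ K" "n \<ge> 2 ^ K"
        then show "dist (S m) (S n) < e"
          using near[of m] near[of n] dist_triangle_half_l[of "S m" "S (2 ^ K)" e "S n"]
          by (simp add: dist_norm norm_minus_commute)
      qed
    qed
    then show ?case
      by (simp add: Cauchy_convergent_iff S_def[abs_def])
  qed
qed

section \<open>The truncated powers of \<open>a\<^sup>2 - \<bar>x\<bar>\<^sup>2\<close>\<close>

text \<open>By the convention \<open>0 powr \<beta> = 0\<close>, which holds for every exponent, the
  truncation gives the value 0 outside the ball even when \<beta> \<le> 0. In this form the function
  is a power of a Lipschitz function.\<close>

lemma bigU_eq: "bigU \<beta> a x = (max 0 (a\<^sup>2 - (norm x)\<^sup>2)) powr \<beta>" if "a > 0"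
proof (cases "norm x < a")
  case True
  then have "(norm x)\<^sup>2 < a\<^sup>2" by (intro power_strict_mono) auto
  then show ?thesis using True by (simp add: bigU_def)
next
  case False
  then have "a\<^sup>2 \<le> (norm x)\<^sup>2" using that by (intro power_mono) auto
  then show ?thesis using False by (simp add: bigU_def)
qed

lemma borel_measurable_bigU [measurable]: "bigU \<beta> a \<in> borel_measurable borel"
  unfolding bigU_def by measurable

lemma bigU_nonneg: "bigU \<beta> a x \<ge> 0"
  by (simp add: bigU_def)

lemma bigU_eq_0: "norm x \<ge> a \<Longrightarrow> bigU \<beta> a x = 0"
  by (simp add: bigU_def)

lemma bigU_power2: "(bigU \<beta> a x)\<^sup>2 = bigU (2 * \<beta>) a x"
  by (simp add: bigU_def powr_add[symmetric] power2_eq_square)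

section \<open>Integrability for exponents above -1\<close>

text \<open>The shell lies in a ball minus the concentric ball of radius a sqrt (1 - \<epsilon>).
  Bernoulli's inequality and sqrt (1 - \<epsilon>) \<ge> 1 - \<epsilon> bound its relative volume by
  d \<epsilon>.\<close>

lemma emeasure_shell_le:
  fixes a \<epsilon> :: real
  assumes "a > 0" "0 \<le> \<epsilon>" "\<epsilon> \<le> 1"
  shows "emeasure lborel {x :: 'a :: euclidean_space. norm x < a \<and> a\<^sup>2 - (norm x)\<^sup>2 \<le> a\<^sup>2 * \<epsilon>}
    \<le> ennreal (unit_ball_vol (DIM('a)) * a ^ DIM('a) * DIM('a) * \<epsilon>)"
proof -
  let ?d = "DIM('a)"
  define r where "r = a * sqrt (1 - \<epsilon>)"
  have "sqrt (1 - \<epsilon>) \<le> 1" using assms(2) by simp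
  moreover have "0 \<le> sqrt (1 - \<epsilon>)" using assms(3) by simp
  ultimately have r: "0 \<le> r" "r \<le> a"
    using assms(1) unfolding r_def by (intro mult_nonneg_nonneg mult_left_le; linarith)+
  have r2: "r\<^sup>2 = a\<^sup>2 - a\<^sup>2 * \<epsilon>"
    using assms by (simp add: r_def power_mult_distrib algebra_simps)
  have "r \<le> norm x" if "a\<^sup>2 - (norm x)\<^sup>2 \<le> a\<^sup>2 * \<epsilon>" for x :: 'a
  proof (rule power2_le_imp_le)
    show "r\<^sup>2 \<le> (norm x)\<^sup>2" using that r2 by linarith
  qed simp
  then have "{x :: 'a. norm x < a \<and> a\<^sup>2 - (norm x)\<^sup>2 \<le> a\<^sup>2 * \<epsilon>} \<subseteq> ball 0 a - ball 0 r"
    by (intro subsetI) (simp add: not_less)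
  then have "emeasure lborel {x :: 'a. norm x < a \<and> a\<^sup>2 - (norm x)\<^sup>2 \<le> a\<^sup>2 * \<epsilon>}
      \<le> emeasure lborel (ball (0::'a) a - ball 0 r)"
    by (intro emeasure_mono) auto
  also have "\<dots> = emeasure lborel (ball (0::'a) a) - emeasure lborel (ball (0::'a) r)"
    using r by (intro emeasure_Diff) (auto simp: emeasure_ball)
  also have "\<dots> = ennreal (unit_ball_vol ?d * a ^ ?d - unit_ball_vol ?d * r ^ ?d)"
    using r assms by (simp add: emeasure_ball ennreal_minus)
  also have "\<dots> \<le> ennreal (unit_ball_vol ?d * a ^ ?d * ?d * \<epsilon>)"
  proof (rule ennreal_leI)
    have "1 - ?d * \<epsilon> \<le> (1 - \<epsilon>) ^ ?d"
      using Bernoulli_inequality[of "- \<epsilon>" ?d] assms by simp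
    also have "\<dots> \<le> sqrt (1 - \<epsilon>) ^ ?d"
    proof (intro power_mono)
      have "(1 - \<epsilon>) * (1 - \<epsilon>) \<le> 1 * (1 - \<epsilon>)" using assms by (intro mult_right_mono) auto
      then show "1 - \<epsilon> \<le> sqrt (1 - \<epsilon>)"
        by (intro real_le_rsqrt) (simp add: power2_eq_square)
    qed (use assms in auto)
    finally have "unit_ball_vol ?d * a ^ ?d * (1 - ?d * \<epsilon>) \<le> unit_ball_vol ?d * a ^ ?d * sqrt (1 - \<epsilon>) ^ ?d"
      using assms by (intro mult_left_mono) auto
    then show "unit_ball_vol ?d * a ^ ?d - unit_ball_vol ?d * r ^ ?d \<le> unit_ball_vol ?d * a ^ ?d * ?d * \<epsilon>"
      by (simp add: r_def power_mult_distrib algebra_simps)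
  qed
  finally show ?thesis .
qed

text \<open>The layer where a^2 - |x|^2 is about a^2 2^(-j) has volume O(2^(-j)) and carries values
  O(2^(-j \<gamma>)). The resulting geometric series has ratio 2^(-(\<gamma> + 1)) < 1.\<close>

lemma integrable_bigU_neg:
  assumes "\<gamma> > -1" "\<gamma> \<le> 0" "a > 0"
  shows "integrable lborel (bigU \<gamma> a :: real ^ 'd \<Rightarrow> real)"
proof (rule integrableI_bounded)
  let ?d = "CARD('d)"
  define A where "A j = {x :: real ^ 'd. norm x < a \<and> a\<^sup>2 - (norm x)\<^sup>2 \<le> a\<^sup>2 * (1/2) ^ j}" for j :: nat
  define c where "c j = (a\<^sup>2 * (1/2) ^ Suc j) powr \<gamma>" for j :: nat
  define V where "V = unit_ball_vol ?d * a ^ ?d * ?d"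
  have V: "V \<ge> 0" using assms by (simp add: V_def)
  have A [measurable]: "A j \<in> sets borel" for j
    unfolding A_def by measurable
  have "ennreal (norm (bigU \<gamma> a x)) \<le> (\<Sum>j. ennreal (c j) * indicator (A j) x)" for x
  proof (cases "norm x < a")
    case True
    define t where "t = (a\<^sup>2 - (norm x)\<^sup>2) / a\<^sup>2"
    have "(norm x)\<^sup>2 < a\<^sup>2" using True by (intro power_strict_mono) auto
    then have t: "0 < t" "t \<le> 1" "a\<^sup>2 - (norm x)\<^sup>2 = a\<^sup>2 * t"
      using assms by (auto simp: t_def field_simps)
    obtain n where "(1/2) ^ n < t"
      using real_arch_pow_inv[of t "1/2"] t by auto
    then have ex: "\<exists>n. (1/2) ^ n < t" by blast
    \<comment> \<open>Since t \<le> 1, the least such n is positive, and its predecessor j satisfies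
      (1/2)^(j+1) < t \<le> (1/2)^j.\<close>
    define n where "n = (LEAST n. (1/2) ^ n < t)"
    have n: "(1/2) ^ n < t" using ex unfolding n_def by (rule LeastI_ex)
    obtain j where j: "n = Suc j" using n t by (cases n) auto
    have "\<not> (1/2) ^ j < t"
      using not_less_Least[of j "\<lambda>n. (1/2) ^ n < t"] j by (simp add: n_def)
    then have "x \<in> A j" using True t assms by (simp add: A_def)
    moreover have "bigU \<gamma> a x \<le> c j"
      unfolding c_def using True t n j assms by (auto simp: bigU_def intro!: powr_mono2')
    ultimately have "ennreal (norm (bigU \<gamma> a x)) \<le> ennreal (c j) * indicator (A j) x"
      by (simp add: bigU_nonneg ennreal_leI)
    also have "\<dots> \<le> (\<Sum>j. ennreal (c j) * indicator (A j) x)"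
    proof -
      define g where "g j = ennreal (c j) * indicator (A j) x" for j
      have "g j \<le> suminf g" using sum_le_suminf[of g "{j}"] by simp
      then show ?thesis unfolding g_def .
    qed
    finally show ?thesis .
  qed (simp add: bigU_def)
  then have "(\<integral>\<^sup>+x. ennreal (norm (bigU \<gamma> a (x :: real ^ 'd))) \<partial>lborel)
      \<le> (\<integral>\<^sup>+x. (\<Sum>j. ennreal (c j) * indicator (A j) x) \<partial>lborel)"
    by (intro nn_integral_mono)
  also have "\<dots> = (\<Sum>j. ennreal (c j) * emeasure lborel (A j))"
    by (subst nn_integral_suminf) (auto simp: nn_integral_cmult_indicator)
  also have "\<dots> \<le> (\<Sum>j. ennreal (c j * (V * (1/2) ^ j)))"
  proof (intro suminf_le)
    fix j
    have "emeasure lborel (A j) \<le> ennreal (V * (1/2) ^ j)"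
      using emeasure_shell_le[of a "(1/2) ^ j", where 'a = "real ^ 'd"] assms
      by (simp add: A_def V_def power_le_one)
    then show "ennreal (c j) * emeasure lborel (A j) \<le> ennreal (c j * (V * (1/2) ^ j))"
      using V by (subst ennreal_mult) (auto simp: c_def intro!: mult_left_mono)
  qed auto
  also have "\<dots> < \<infinity>"
  proof -
    define q where "q = (1/2) powr (\<gamma> + 1)"
    have q: "0 < q" "q < 1"
      using assms powr_less_mono2[of "\<gamma> + 1" "1/2" 1] by (auto simp: q_def)
    have "c j * (V * (1/2) ^ j) = (V * (a\<^sup>2 / 2) powr \<gamma>) * q ^ j" for j
    proof -
      have "(1/2 :: real) ^ j = (1/2) powr j" by (simp add: powr_realpow)
      moreover have "((1/2 :: real) powr j) powr \<gamma> * (1/2) powr j = q ^ j"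
        by (simp add: q_def powr_powr powr_add[symmetric] powr_power algebra_simps)
      moreover have "c j = (a\<^sup>2 / 2) powr \<gamma> * ((1/2) ^ j) powr \<gamma>"
        by (subst powr_mult[symmetric]) (auto simp: c_def)
      ultimately show ?thesis by (simp add: mult_ac)
    qed
    then have "(\<lambda>j. c j * (V * (1/2) ^ j)) = (\<lambda>j. (V * (a\<^sup>2 / 2) powr \<gamma>) * q ^ j)"
      by (rule ext)
    then have "summable (\<lambda>j. c j * (V * (1/2) ^ j))"
      using q by (simp only:) (intro summable_mult summable_geometric, simp)
    then show ?thesis
      using V by (subst suminf_ennreal2) (auto simp: c_def)
  qed
  finally show "(\<integral>\<^sup>+x. ennreal (norm (bigU \<gamma> a (x :: real ^ 'd))) \<partial>lborel) < \<infinity>" .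
qed simp

lemma integrable_bigU:
  assumes "\<gamma> > -1" "a > 0"
  shows "integrable lborel (bigU \<gamma> a :: real ^ 'd \<Rightarrow> real)"
proof (cases "\<gamma> \<le> 0")
  case False
  show ?thesis
  proof (rule Bochner_Integration.integrable_bound)
    \<comment> \<open>\<open>bigU 0 a\<close> is the indicator of the open ball, on which a positive
      power is bounded.\<close>
    show "integrable lborel (\<lambda>x :: real ^ 'd. (a\<^sup>2) powr \<gamma> * bigU 0 a x)"
      using integrable_bigU_neg[of 0 a] assms by simp
    show "AE x :: real ^ 'd in lborel. norm (bigU \<gamma> a x) \<le> norm ((a\<^sup>2) powr \<gamma> * bigU 0 a x)"
    proof (intro AE_I2)
      fix x :: "real ^ 'd"
      have "(norm x)\<^sup>2 < a\<^sup>2" if "norm x < a" using that by (intro power_strict_mono) auto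
      then show "norm (bigU \<gamma> a x) \<le> norm ((a\<^sup>2) powr \<gamma> * bigU 0 a x)"
        using False by (auto simp: bigU_def intro!: powr_mono2)
    qed
  qed simp
qed (use assms integrable_bigU_neg in blast)

section \<open>Differences of truncated powers\<close>

text \<open>For \<open>t > s / 2\<close> the mean value theorem applies away from \<open>0\<close>; otherwise both \<open>s\<close> and \<open>t\<close>
  are at most twice \<open>s - t\<close>.\<close>

lemma abs_powr_diff_le:
  fixes s t \<beta> \<eta> :: real
  assumes \<eta>: "0 < \<eta>" "\<eta> \<le> 1" and st: "0 \<le> t" "t \<le> s"
  shows "\<bar>s powr \<beta> - t powr \<beta>\<bar> \<le> (2 + \<bar>\<beta>\<bar>) * (s - t) powr \<eta> * (s powr (\<beta> - \<eta>) + t powr (\<beta> - \<eta>))"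
proof (cases "t \<le> s / 2")
  case True
  show ?thesis
  proof (cases "s = 0")
    case False
    then have s: "s > 0" using st by simp
    have split: "r powr \<beta> \<le> 2 * (s - t) powr \<eta> * r powr (\<beta> - \<eta>)" if r: "0 \<le> r" "r \<le> 2 * (s - t)" for r
    proof (cases "r = 0")
      case False
      have "r powr \<beta> = r powr \<eta> * r powr (\<beta> - \<eta>)"
        by (simp add: powr_add[symmetric])
      also have "r powr \<eta> \<le> (2 * (s - t)) powr \<eta>"
        using r \<eta> by (intro powr_mono2) auto
      also have "\<dots> = 2 powr \<eta> * (s - t) powr \<eta>"
        using st by (intro powr_mult)
      also have "2 powr \<eta> \<le> (2 :: real)"
        using powr_mono[of \<eta> 1 2] \<eta> by simp
      finally show ?thesis by (simp add: mult_right_mono)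
    qed simp
    have "\<bar>s powr \<beta> - t powr \<beta>\<bar> \<le> s powr \<beta> + t powr \<beta>"
      by (simp add: abs_le_iff)
    also have "\<dots> \<le> 2 * (s - t) powr \<eta> * s powr (\<beta> - \<eta>) + 2 * (s - t) powr \<eta> * t powr (\<beta> - \<eta>)"
      using st True by (intro add_mono split) auto
    also have "\<dots> = 2 * ((s - t) powr \<eta> * (s powr (\<beta> - \<eta>) + t powr (\<beta> - \<eta>)))"
      by (simp add: algebra_simps)
    also have "\<dots> \<le> (2 + \<bar>\<beta>\<bar>) * ((s - t) powr \<eta> * (s powr (\<beta> - \<eta>) + t powr (\<beta> - \<eta>)))"
      by (intro mult_right_mono) auto
    finally show ?thesis by (simp add: mult_ac)
  qed (use st in simp)
next
  case False
  show ?thesis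
  proof (cases "s = t")
    case st_ne: False
    have t0: "t > 0" using False st by simp
    have "t < s" using st st_ne by simp
    have "\<exists>z. t < z \<and> z < s \<and> s powr \<beta> - t powr \<beta> = (s - t) * (\<beta> * z powr (\<beta> - 1))"
      using t0 by (intro MVT2 \<open>t < s\<close>) (auto intro!: derivative_eq_intros simp: powr_diff)
    then obtain z where z: "t < z" "z < s" "s powr \<beta> - t powr \<beta> = (s - t) * (\<beta> * z powr (\<beta> - 1))"
      by blast
    have "\<bar>s powr \<beta> - t powr \<beta>\<bar> = \<bar>\<beta>\<bar> * ((s - t) * z powr (\<beta> - 1))"
      using st by (simp add: z(3) abs_mult mult_ac)
    also have "s - t = (s - t) powr \<eta> * (s - t) powr (1 - \<eta>)"
      using \<open>t < s\<close> by (simp add: powr_add[symmetric])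
    \<comment> \<open>From s / 2 < t one gets s - t < t < z.\<close>
    also have "(s - t) powr (1 - \<eta>) \<le> z powr (1 - \<eta>)"
      using z False \<eta> \<open>t < s\<close> by (intro powr_mono2) auto
    also have "(s - t) powr \<eta> * z powr (1 - \<eta>) * z powr (\<beta> - 1) = (s - t) powr \<eta> * z powr (\<beta> - \<eta>)"
      by (simp add: powr_add[symmetric] mult.assoc)
    \<comment> \<open>The sign of \<beta> - \<eta> decides which endpoint dominates; this is why the
      bound carries both end values.\<close>
    also have "z powr (\<beta> - \<eta>) \<le> s powr (\<beta> - \<eta>) + t powr (\<beta> - \<eta>)"
    proof (cases "\<beta> - \<eta> \<ge> 0")
      case True
      then have "z powr (\<beta> - \<eta>) \<le> s powr (\<beta> - \<eta>)" using z t0 by (intro powr_mono2) auto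
      then show ?thesis by (simp add: add_increasing2)
    next
      case False
      then have "z powr (\<beta> - \<eta>) \<le> t powr (\<beta> - \<eta>)" using z t0 by (intro powr_mono2') auto
      then show ?thesis by (simp add: add_increasing)
    qed
    also have "\<bar>\<beta>\<bar> * ((s - t) powr \<eta> * (s powr (\<beta> - \<eta>) + t powr (\<beta> - \<eta>)))
        \<le> (2 + \<bar>\<beta>\<bar>) * ((s - t) powr \<eta> * (s powr (\<beta> - \<eta>) + t powr (\<beta> - \<eta>)))"
      by (intro mult_right_mono) auto
    finally show ?thesis by (simp add: mult_left_mono mult_right_mono mult_ac)
  qed simp
qed

text \<open>The function a^2 - |x|^2 cut off at 0 is Lipschitz with constant 2 a, so the scalar
  estimate applies with s - t \<le> 2 a |x - y|.\<close>

lemma abs_bigU_diff_le: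
  fixes x y :: "real ^ 'd"
  assumes a: "a > 0" and \<eta>: "0 < \<eta>" "\<eta> \<le> 1"
  shows "\<bar>bigU \<beta> a x - bigU \<beta> a y\<bar>
    \<le> (2 + \<bar>\<beta>\<bar>) * (2 * a * norm (x - y)) powr \<eta> * (bigU (\<beta> - \<eta>) a x + bigU (\<beta> - \<eta>) a y)"
proof -
  define p where "p x = max 0 (a\<^sup>2 - (norm x)\<^sup>2)" for x :: "real ^ 'd"
  have lip: "p x - p y \<le> 2 * a * norm (x - y)" for x y :: "real ^ 'd"
  proof (cases "norm x < a")
    case True
    have x: "(norm x)\<^sup>2 \<le> a\<^sup>2" using True by (intro power_mono) auto
    \<comment> \<open>Capping |y| at a leaves \<open>p y\<close> unchanged and keeps the factor v +
      |x| below 2 a.\<close>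
    define v where "v = min a (norm y)"
    have "p y = a\<^sup>2 - v\<^sup>2"
    proof (cases "norm y < a")
      case True
      then have "(norm y)\<^sup>2 \<le> a\<^sup>2" by (intro power_mono) auto
      then show ?thesis using True by (simp add: p_def v_def min_def)
    next
      case False
      then have "a\<^sup>2 \<le> (norm y)\<^sup>2" using a by (intro power_mono) auto
      then show ?thesis using False by (simp add: p_def v_def min_def)
    qed
    then have "p x - p y = (v + norm x) * (v - norm x)"
      using x by (simp add: p_def power2_eq_square algebra_simps)
    also have "\<dots> \<le> (v + norm x) * norm (x - y)"
      using norm_triangle_ineq2[of y x] a
      by (intro mult_left_mono) (auto simp: v_def norm_minus_commute)
    also have "\<dots> \<le> (2 * a) * norm (x - y)"
      using True by (intro mult_right_mono) (auto simp: v_def)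
    finally show ?thesis .
  next
    case False
    then have "a\<^sup>2 \<le> (norm x)\<^sup>2" using a by (intro power_mono) auto
    then have "p x - p y \<le> 0" by (simp add: p_def)
    then show ?thesis using a by (smt (verit) mult_nonneg_nonneg norm_ge_zero)
  qed
  have main: "\<bar>bigU \<beta> a x - bigU \<beta> a y\<bar>
    \<le> (2 + \<bar>\<beta>\<bar>) * (2 * a * norm (x - y)) powr \<eta> * (bigU (\<beta> - \<eta>) a x + bigU (\<beta> - \<eta>) a y)"
    if "p y \<le> p x" for x y :: "real ^ 'd"
  proof -
    have "\<bar>bigU \<beta> a x - bigU \<beta> a y\<bar> = \<bar>p x powr \<beta> - p y powr \<beta>\<bar>"
      unfolding bigU_eq[OF a] p_def ..
    also have "\<dots> \<le> (2 + \<bar>\<beta>\<bar>) * (p x - p y) powr \<eta> * (p x powr (\<beta> - \<eta>) + p y powr (\<beta> - \<eta>))"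
      using that \<eta> by (intro abs_powr_diff_le) (auto simp: p_def)
    also have "\<dots> \<le> (2 + \<bar>\<beta>\<bar>) * (2 * a * norm (x - y)) powr \<eta> * (p x powr (\<beta> - \<eta>) + p y powr (\<beta> - \<eta>))"
      using lip[of x y] that \<eta> by (intro mult_right_mono mult_left_mono powr_mono2) auto
    finally show ?thesis unfolding bigU_eq[OF a] p_def .
  qed
  show ?thesis
  proof (cases "p y \<le> p x")
    case False
    then have "p x \<le> p y" by simp
    from main[OF this] show ?thesis
      by (simp add: abs_minus_commute norm_minus_commute add.commute)
  qed (rule main)
qed

section \<open>Decay of the Fourier coefficients\<close>

text \<open>A finite sum stands in for the sum over the whole lattice; on the torus the two agree
  when \<open>D\<close> vanishes outside the ball of radius \<open>r\<close>.\<close>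

definition periodization :: "real \<Rightarrow> (real ^ 'd \<Rightarrow> 'b::comm_monoid_add) \<Rightarrow> real ^ 'd \<Rightarrow> 'b" where
  "periodization r D x = (\<Sum>k\<in>lattice_ball r. D (x + k))"

text \<open>Cauchy-Schwarz over the finitely many translates gives the mean square bound. Unfolding
  the integral over the cube to the whole space identifies the coefficients with values of the
  Fourier transform of \<open>D\<close> at lattice points.\<close>

lemma
  fixes D :: "real ^ 'd \<Rightarrow> complex"
  assumes meas [measurable]: "D \<in> borel_measurable borel"
    and int2: "integrable lborel (\<lambda>x. (norm (D x))\<^sup>2)"
    and supp: "\<And>x. norm x > r \<Longrightarrow> D x = 0"
  shows square_integrable_periodization: "square_integrable (periodization r D)"
    and integral_norm2_periodization_le: "(LINT x|torus_measure. (norm (periodization r D x))\<^sup>2)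
      \<le> card (lattice_ball r :: (real ^ 'd) set) * (LBINT x. (norm (D x))\<^sup>2)"
    and fourier_coeff_periodization: "m \<in> int_lattice \<Longrightarrow>
      has_bochner_integral lborel (\<lambda>x. D x * cnj (character m x)) (fourier_coeff (periodization r D) m)"
proof -
  let ?L = "lattice_ball r :: (real ^ 'd) set"
  have cover: "k \<in> ?L" if "D x \<noteq> 0" "k \<in> int_lattice" "x - k \<in> torus" for x k
    using that supp[of x] by (intro lattice_ball_cover[of x]) (auto simp: not_less[symmetric])
  have [measurable]: "periodization r D \<in> borel_measurable borel"
    unfolding periodization_def by measurable
  then have meas_T [measurable]: "periodization r D \<in> borel_measurable torus_measure"
    by (rule borel_measurable_torus)
  have "has_bochner_integral torus_measure (\<lambda>x. \<Sum>k\<in>?L. (norm (D (x + k)))\<^sup>2) (LBINT x. (norm (D x))\<^sup>2)"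
    by (intro torus_unfold lattice_ball has_bochner_integral_integrable int2) (auto intro: cover)
  from has_bochner_integral_mult_right[OF this, of "real (card ?L)"]
  have sq: "has_bochner_integral torus_measure (\<lambda>x. card ?L * (\<Sum>k\<in>?L. (norm (D (x + k)))\<^sup>2))
      (card ?L * (LBINT x. (norm (D x))\<^sup>2))"
    by simp
  have le: "(norm (periodization r D x))\<^sup>2 \<le> card ?L * (\<Sum>k\<in>?L. (norm (D (x + k)))\<^sup>2)" for x
  proof -
    have "(norm (periodization r D x))\<^sup>2 \<le> (\<Sum>k\<in>?L. norm (D (x + k)))\<^sup>2"
      unfolding periodization_def by (intro power_mono norm_sum norm_ge_zero)
    also have "\<dots> \<le> (\<Sum>k\<in>?L. (norm (D (x + k)))\<^sup>2) * card ?L"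
      by (rule sum_squared_le_sum_of_squares)
    finally show ?thesis by (simp add: mult.commute)
  qed
  have int_p: "integrable torus_measure (\<lambda>x. (norm (periodization r D x))\<^sup>2)"
  proof (rule Bochner_Integration.integrable_bound)
    show "integrable torus_measure (\<lambda>x. card ?L * (\<Sum>k\<in>?L. (norm (D (x + k)))\<^sup>2))"
      using sq by (simp add: has_bochner_integral_iff)
    show "AE x in torus_measure. norm ((norm (periodization r D x))\<^sup>2)
        \<le> norm (card ?L * (\<Sum>k\<in>?L. (norm (D (x + k)))\<^sup>2))"
      using le by (simp add: sum_nonneg)
  qed measurable
  then show "square_integrable (periodization r D)"
    using meas_T by unfold_locales
  show "(LINT x|torus_measure. (norm (periodization r D x))\<^sup>2) \<le> card ?L * (LBINT x. (norm (D x))\<^sup>2)"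
    using integral_mono[OF int_p _ le] sq by (auto simp: has_bochner_integral_iff)
  assume m: "m \<in> int_lattice"
  \<comment> \<open>Bounded support turns square integrability into integrability, by t \<le> 1 +
    t^2 on the ball.\<close>
  have intD: "integrable lborel D"
  proof (rule Bochner_Integration.integrable_bound)
    show "integrable lborel (\<lambda>x :: real ^ 'd. indicator (cball 0 r) x + (norm (D x))\<^sup>2 :: real)"
      using int2 by (intro Bochner_Integration.integrable_add integrable_real_indicator
          emeasure_bounded_finite) auto
    have "t \<le> 1 + t\<^sup>2" for t :: real
      using zero_le_power2[of "t - 1/2"] by (simp add: power2_eq_square algebra_simps)
    then show "AE x in lborel. norm (D x) \<le> norm (indicator (cball 0 r) x + (norm (D x))\<^sup>2 :: real)"
      using supp by (intro AE_I2) (auto simp: indicator_def)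
  qed simp
  have "integrable lborel (\<lambda>x. D x * cnj (character m x))"
    by (rule Bochner_Integration.integrable_bound[OF intD])
      (auto simp: norm_mult simp flip: character_minus)
  then have int: "has_bochner_integral lborel (\<lambda>x. D x * cnj (character m x))
      (LBINT x. D x * cnj (character m x))"
    by (rule has_bochner_integral_integrable)
  then have "has_bochner_integral torus_measure (\<lambda>x. \<Sum>k\<in>?L. D (x + k) * cnj (character m (x + k)))
      (LBINT x. D x * cnj (character m x))"
    by (rule torus_unfold) (use lattice_ball in \<open>auto intro: cover\<close>)
  also have "(\<lambda>x. \<Sum>k\<in>?L. D (x + k) * cnj (character m (x + k)))
      = (\<lambda>x. periodization r D x * cnj (character m x))"
    unfolding periodization_def sum_distrib_right
    by (intro ext sum.cong refl) (simp add: character_shift[OF m] subsetD[OF lattice_ball(2)])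
  finally show "has_bochner_integral lborel (\<lambda>x. D x * cnj (character m x)) (fourier_coeff (periodization r D) m)"
    using int by (simp add: fourier_coeff_eq has_bochner_integral_iff)
qed

lemma periodU_eq_periodization:
  assumes "x \<in> torus" "r \<ge> a"
  shows "periodU \<beta> a x = periodization r (bigU \<beta> a) (x :: real ^ 'd)"
proof -
  have "periodU \<beta> a x = (\<Sum>\<^sub>\<infinity>m\<in>lattice_ball r. bigU \<beta> a (x + m))"
    unfolding periodU_def
  proof (rule infsum_cong_neutral)
    fix m :: "real ^ 'd" assume m: "m \<in> int_lattice - lattice_ball r"
    show "bigU \<beta> a (x + m) = 0"
    proof (rule ccontr)
      assume "bigU \<beta> a (x + m) \<noteq> 0"
      then have "norm (x + m) \<le> r" using assms by (auto simp: bigU_def split: if_splits)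
      then show False using lattice_ball_cover[of "x + m" r m] m assms by simp
    qed
  qed (use lattice_ball in auto)
  then show ?thesis by (simp add: periodization_def lattice_ball)
qed

abbreviation coeffU :: "real \<Rightarrow> real \<Rightarrow> real ^ 'd \<Rightarrow> complex" where
  "coeffU \<beta> a \<equiv> fourier_coeff (\<lambda>y. complex_of_real (periodU \<beta> a y))"

text \<open>The condition 2 \<beta> > -1 makes the square of the singularity integrable, so the
  facts on periodizations apply to \<open>bigU\<close>.\<close>

lemma
  assumes "\<beta> > - 1/2" "a > 0"
  shows square_integrable_periodU:
      "square_integrable (\<lambda>y :: real ^ 'd. complex_of_real (periodU \<beta> a y))"
    and coeffU: "(m :: real ^ 'd) \<in> int_lattice \<Longrightarrow>
      has_bochner_integral lborel (\<lambda>x. of_real (bigU \<beta> a x) * cnj (character m x)) (coeffU \<beta> a m)"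
proof -
  define D where "D x = complex_of_real (bigU \<beta> a x)" for x :: "real ^ 'd"
  have D: "D \<in> borel_measurable borel" "integrable lborel (\<lambda>x. (norm (D x))\<^sup>2)"
      "\<And>x. norm x > a \<Longrightarrow> D x = 0"
    using integrable_bigU[of "2 * \<beta>" a] assms
    by (auto simp: D_def[abs_def] bigU_nonneg bigU_power2 bigU_eq_0)
  have eq: "complex_of_real (periodU \<beta> a x) = periodization a D x" if "x \<in> torus" for x :: "real ^ 'd"
    using that by (simp add: periodU_eq_periodization[of x a a] periodization_def D_def)
  interpret square_integrable "periodization a D"
    by (rule square_integrable_periodization) (use D in auto)
  show "square_integrable (\<lambda>y :: real ^ 'd. complex_of_real (periodU \<beta> a y))"
  proof
    show "(\<lambda>y :: real ^ 'd. complex_of_real (periodU \<beta> a y)) \<in> borel_measurable torus_measure"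
      using meas by (subst measurable_cong[where g = "periodization a D"]) (auto simp: eq)
    show "integrable torus_measure (\<lambda>y :: real ^ 'd. (norm (complex_of_real (periodU \<beta> a y)))\<^sup>2)"
      using int2 by (subst Bochner_Integration.integrable_cong[OF refl,
            where g = "\<lambda>x. (norm (periodization a D x))\<^sup>2"]) (auto simp: eq simp del: norm_of_real)
  qed
  have "coeffU \<beta> a m = fourier_coeff (periodization a D) m" for m :: "real ^ 'd"
    unfolding fourier_coeff_eq by (intro Bochner_Integration.integral_cong refl) (simp add: eq)
  then show "(m :: real ^ 'd) \<in> int_lattice \<Longrightarrow> has_bochner_integral lborel
      (\<lambda>x. of_real (bigU \<beta> a x) * cnj (character m x)) (coeffU \<beta> a m)"
    using fourier_coeff_periodization[of D a m] D by (simp add: D_def)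
qed

section \<open>Mean square decay of the coefficients from shifts\<close>

text \<open>The difference U(x + h) - U(x) periodizes to a function with coefficients (e^(2 pi i m
  h) - 1) c(m). Bessel's inequality bounds the weighted sum by the mean square of the difference,
  uniformly in \<open>F\<close>; the exponent delivered is twice the one of the pointwise
  estimate.\<close>

lemma sum_coeffU_shift_le:
  assumes \<beta>: "\<beta> > - 1/2" and a: "a > 0"
  obtains K \<eta> where "\<eta> > 0" "\<And>F h. finite F \<Longrightarrow> F \<subseteq> int_lattice \<Longrightarrow> norm (h :: real ^ 'd) \<le> 1 \<Longrightarrow>
    (\<Sum>m\<in>F. (norm (character m h - 1))\<^sup>2 * (norm (coeffU \<beta> a m))\<^sup>2) \<le> K * norm h powr \<eta>"
proof -
  \<comment> \<open>This choice gives 2 (\<beta> - \<eta>) \<ge> \<beta> - 1/2 > -1; the pointwise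
    difference estimate asks for \<eta> \<le> 1.\<close>
  define \<eta> where "\<eta> = min 1 ((\<beta> + 1/2) / 2)"
  have \<eta>: "0 < \<eta>" "\<eta> \<le> 1" "2 * (\<beta> - \<eta>) > -1"
    using \<beta> by (auto simp: \<eta>_def min_def field_simps)
  define W where "W = (bigU (\<beta> - \<eta>) a :: real ^ 'd \<Rightarrow> real)"
  have [measurable]: "W \<in> borel_measurable borel" by (simp add: W_def)
  define I where "I = (LBINT x. (W x)\<^sup>2)"
  have W: "has_bochner_integral lborel (\<lambda>x. (W x)\<^sup>2) I"
    using integrable_bigU[OF \<eta>(3) a] by (simp add: I_def W_def bigU_power2 has_bochner_integral_iff)
  \<comment> \<open>For |h| \<le> 1 the difference is supported in the ball of radius a + 1, so one
    set of translates, hence one constant, serves all shifts.\<close>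
  let ?N = "real (card (lattice_ball (a + 1) :: (real ^ 'd) set))"
  let ?C = "(2 + \<bar>\<beta>\<bar>) * (2 * a) powr \<eta>"
  have main: "(\<Sum>m\<in>F. (norm (character m h - 1))\<^sup>2 * (norm (coeffU \<beta> a m))\<^sup>2)
      \<le> (?N * (?C\<^sup>2 * (4 * I))) * norm h powr (2 * \<eta>)"
    if F: "finite F" "F \<subseteq> int_lattice" and h: "norm h \<le> 1" for F and h :: "real ^ 'd"
  proof -
    define D where "D x = complex_of_real (bigU \<beta> a (x + h) - bigU \<beta> a x)" for x :: "real ^ 'd"
    have D_meas [measurable]: "D \<in> borel_measurable borel"
      unfolding D_def[abs_def] by measurable
    let ?B = "\<lambda>x. (?C * norm h powr \<eta>)\<^sup>2 * (2 * (W (x + h))\<^sup>2 + 2 * (W x)\<^sup>2)"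
    have B: "has_bochner_integral lborel ?B ((?C * norm h powr \<eta>)\<^sup>2 * (2 * I + 2 * I))"
      by (intro has_bochner_integral_mult_right has_bochner_integral_add W
          has_bochner_integral_lborel_plus[OF W])
    have D_le: "(norm (D x))\<^sup>2 \<le> ?B x" for x
    proof -
      have "norm (D x) = \<bar>bigU \<beta> a (x + h) - bigU \<beta> a x\<bar>"
        unfolding D_def by (rule norm_of_real)
      also have "\<dots> \<le> (2 + \<bar>\<beta>\<bar>) * (2 * a * norm h) powr \<eta> * (W (x + h) + W x)"
        using abs_bigU_diff_le[OF a \<eta>(1,2), of \<beta> "x + h" x] by (simp add: W_def)
      also have "(2 + \<bar>\<beta>\<bar>) * (2 * a * norm h) powr \<eta> = ?C * norm h powr \<eta>"
        using a by (simp add: powr_mult)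
      finally have "(norm (D x))\<^sup>2 \<le> (?C * norm h powr \<eta> * (W (x + h) + W x))\<^sup>2"
        by (intro power_mono) auto
      also have "\<dots> = (?C * norm h powr \<eta>)\<^sup>2 * (W (x + h) + W x)\<^sup>2"
        by (rule power_mult_distrib)
      also have "(W (x + h) + W x)\<^sup>2 \<le> 2 * (W (x + h))\<^sup>2 + 2 * (W x)\<^sup>2"
        using zero_le_power2[of "W (x + h) - W x"] by (simp add: power2_eq_square algebra_simps)
      finally show ?thesis by (simp add: mult_left_mono)
    qed
    have D_int: "integrable lborel (\<lambda>x. (norm (D x))\<^sup>2)"
    proof (rule Bochner_Integration.integrable_bound)
      show "integrable lborel ?B" using B by (simp add: has_bochner_integral_iff)
      show "AE x in lborel. norm ((norm (D x))\<^sup>2) \<le> norm (?B x)"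
        using order_trans[OF D_le abs_ge_self] by (intro AE_I2) simp
    qed measurable
    have D_supp: "D x = 0" if "norm x > a + 1" for x
    proof -
      have "norm x \<le> norm (x + h) + norm h"
        using norm_triangle_ineq4[of "x + h" h] by simp
      then show ?thesis using that h by (simp add: D_def bigU_eq_0)
    qed
    have coeff: "fourier_coeff (periodization (a + 1) D) m = (character m h - 1) * coeffU \<beta> a m"
      if m: "m \<in> int_lattice" for m
    proof -
      note U = coeffU[OF \<beta> a m]
      have "has_bochner_integral lborel
          (\<lambda>x. character m h * (of_real (bigU \<beta> a (x + h)) * cnj (character m (x + h)))
             - of_real (bigU \<beta> a x) * cnj (character m x))
          (character m h * coeffU \<beta> a m - coeffU \<beta> a m)"
        by (intro has_bochner_integral_diff has_bochner_integral_mult_right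
            has_bochner_integral_lborel_plus[OF U] U)
      also have "(\<lambda>x. character m h * (of_real (bigU \<beta> a (x + h)) * cnj (character m (x + h)))
             - of_real (bigU \<beta> a x) * cnj (character m x)) = (\<lambda>x. D x * cnj (character m x))"
      proof
        fix x
        have "character m h * cnj (character m h) = 1"
          by (simp add: complex_norm_square[symmetric])
        then have "character m h * cnj (character m (x + h)) = cnj (character m x)"
          by (simp add: character_add_right mult_ac)
        then have "character m h * (of_real (bigU \<beta> a (x + h)) * cnj (character m (x + h)))
            = of_real (bigU \<beta> a (x + h)) * cnj (character m x)"
          by (metis mult.left_commute)
        then show "character m h * (of_real (bigU \<beta> a (x + h)) * cnj (character m (x + h)))
             - of_real (bigU \<beta> a x) * cnj (character m x) = D x * cnj (character m x)"
          by (simp add: D_def left_diff_distrib)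
      qed
      finally have "has_bochner_integral lborel (\<lambda>x. D x * cnj (character m x))
        (character m h * coeffU \<beta> a m - coeffU \<beta> a m)" .
      from has_bochner_integral_eq[OF fourier_coeff_periodization[OF D_meas D_int D_supp m] this]
      show ?thesis by (simp add: left_diff_distrib)
    qed
    have "(\<Sum>m\<in>F. (norm (character m h - 1))\<^sup>2 * (norm (coeffU \<beta> a m))\<^sup>2)
        = (\<Sum>m\<in>F. (norm (fourier_coeff (periodization (a + 1) D) m))\<^sup>2)"
      using F(2) by (intro sum.cong refl) (auto simp: coeff norm_mult power_mult_distrib)
    also have "\<dots> \<le> (LINT x|torus_measure. (norm (periodization (a + 1) D x))\<^sup>2)"
      by (intro bessel_inequality square_integrable_periodization F D_meas D_int D_supp)
    also have "\<dots> \<le> ?N * (LBINT x. (norm (D x))\<^sup>2)"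
      by (intro integral_norm2_periodization_le D_meas D_int D_supp)
    also have "\<dots> \<le> ?N * (LBINT x. ?B x)"
      using B D_le D_int by (intro mult_left_mono integral_mono) (auto simp: has_bochner_integral_iff)
    also have "(LBINT x. ?B x) = (?C * norm h powr \<eta>)\<^sup>2 * (4 * I)"
      using B by (simp add: has_bochner_integral_iff)
    also have "(?C * norm h powr \<eta>)\<^sup>2 = ?C\<^sup>2 * norm h powr (2 * \<eta>)"
    proof -
      have "(norm h powr \<eta>)\<^sup>2 = norm h powr (2 * \<eta>)"
        unfolding mult_2 powr_add by (rule power2_eq_square)
      then show ?thesis by (simp add: power_mult_distrib)
    qed
    finally show ?thesis by (simp add: mult_ac)
  qed
  show thesis
    by (rule that[of "2 * \<eta>"]) (use \<eta> main in auto)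
qed

lemma norm_cis_minus_1: "(norm (cis t - 1))\<^sup>2 = 2 - 2 * cos t"
  using sin_cos_squared_add[of t] unfolding cmod_power2 by (simp add: power2_eq_square algebra_simps)

text \<open>Averaging the shift estimate over \<open>h = t *\<^sub>R axis i 1\<close> with \<open>0 \<le> t \<le> T\<close> bounds
  all frequencies with \<open>\<bar>m $ i\<bar> \<ge> 1 / T\<close> at once.\<close>

lemma sum_coeffU_coordinate_tail_le:
  assumes \<beta>: "\<beta> > - 1/2" and a: "a > 0"
  obtains K \<eta> where "\<eta> > 0" "K \<ge> 0" "\<And>F i T. finite F \<Longrightarrow> F \<subseteq> (int_lattice :: (real ^ 'd) set) \<Longrightarrow>
    0 < T \<Longrightarrow> T \<le> 1 \<Longrightarrow> (\<And>m. m \<in> F \<Longrightarrow> 1 / T \<le> \<bar>m $ i\<bar>) \<Longrightarrow>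
    (\<Sum>m\<in>F. (norm (coeffU \<beta> a m))\<^sup>2) \<le> K * T powr \<eta>"
proof -
  obtain K \<eta> where \<eta>: "\<eta> > 0" and K: "\<And>F h. finite F \<Longrightarrow> F \<subseteq> int_lattice \<Longrightarrow> norm (h :: real ^ 'd) \<le> 1 \<Longrightarrow>
    (\<Sum>m\<in>F. (norm (character m h - 1))\<^sup>2 * (norm (coeffU \<beta> a m))\<^sup>2) \<le> K * norm h powr \<eta>"
    by (rule sum_coeffU_shift_le[OF \<beta> a], rule that)
  have main: "(\<Sum>m\<in>F. (norm (coeffU \<beta> a m))\<^sup>2) \<le> max 0 K * T powr \<eta>"
    if F: "finite F" "F \<subseteq> (int_lattice :: (real ^ 'd) set)" and T: "0 < T" "T \<le> 1"
      and large: "\<And>m. m \<in> F \<Longrightarrow> 1 / T \<le> \<bar>m $ i\<bar>" for F i T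
  proof -
    let ?c = "\<lambda>m. (norm (coeffU \<beta> a m))\<^sup>2"
    define g where "g t = (\<Sum>m\<in>F. (2 - 2 * cos (2 * pi * m $ i * t)) * ?c m)" for t
    \<comment> \<open>An antiderivative of \<open>g\<close>. Its increment over [0, T] is bounded
      above by the shift estimate and below by T times the sum of squared coefficients.\<close>
    define G where "G t = (\<Sum>m\<in>F. (2 * t - sin (2 * pi * m $ i * t) / (pi * m $ i)) * ?c m)" for t
    have nz: "m $ i \<noteq> 0" if "m \<in> F" for m
    proof -
      have "0 < 1 / T" using T by simp
      then have "0 < \<bar>m $ i\<bar>" using large[OF that] by linarith
      then show ?thesis by simp
    qed
    have "(G has_real_derivative g t) (at t within {0..T})" for t
      unfolding G_def g_def
    proof (intro DERIV_sum)
      fix m assume "m \<in> F"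
      then show "((\<lambda>t. (2 * t - sin (2 * pi * m $ i * t) / (pi * m $ i)) * ?c m) has_real_derivative
          (2 - 2 * cos (2 * pi * m $ i * t)) * ?c m) (at t within {0..T})"
        using nz[of m] by (auto intro!: derivative_eq_intros simp: field_simps)
    qed
    then have int: "(g has_integral G T - G 0) {0..T}"
      using T by (intro fundamental_theorem_of_calculus)
        (auto simp: has_real_derivative_iff_has_vector_derivative[symmetric])
    have "g t \<le> max 0 K * T powr \<eta>" if t: "t \<in> {0..T}" for t
    proof -
      have "g t = (\<Sum>m\<in>F. (norm (character m (t *\<^sub>R axis i 1) - 1))\<^sup>2 * ?c m)"
        unfolding g_def character_def norm_cis_minus_1
        by (intro sum.cong refl) (simp add: inner_axis mult_ac)
      also have "\<dots> \<le> K * norm (t *\<^sub>R axis i 1 :: real ^ 'd) powr \<eta>"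
        using t T by (intro K F) (auto simp: norm_axis_1)
      also have "\<dots> = K * t powr \<eta>"
        using t by (simp add: norm_axis_1)
      also have "\<dots> \<le> max 0 K * T powr \<eta>"
        using t \<eta> by (intro mult_mono powr_mono2) auto
      finally show ?thesis .
    qed
    then have "G T - G 0 \<le> max 0 K * T powr \<eta> * T"
      using has_integral_le[OF int has_integral_const_real[of "max 0 K * T powr \<eta>" 0 T]] T
      by (simp add: mult_ac)
    moreover have "G 0 = 0" by (simp add: G_def)
    \<comment> \<open>The oscillating part of each integrated weight is at most 1 / (pi |m $ i|)
      \<le> T in modulus, which leaves at least 2 T - T = T.\<close>
    moreover have "(\<Sum>m\<in>F. T * ?c m) \<le> G T"
      unfolding G_def
    proof (intro sum_mono mult_right_mono)
      fix m assume m: "m \<in> F"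
      have "\<bar>sin (2 * pi * m $ i * T) / (pi * m $ i)\<bar> \<le> 1 / (pi * \<bar>m $ i\<bar>)"
        using nz[OF m] by (simp add: abs_mult divide_right_mono)
      also have "\<dots> \<le> 1 / (1 * (1 / T))"
        using large[OF m] T pi_gt3 by (intro divide_left_mono mult_mono) (auto intro!: mult_pos_pos simp: nz m)
      finally show "T \<le> 2 * T - sin (2 * pi * m $ i * T) / (pi * m $ i)"
        using abs_ge_self[of "sin (2 * pi * m $ i * T) / (pi * m $ i)"] by simp
    qed simp
    ultimately have "T * (\<Sum>m\<in>F. ?c m) \<le> T * (max 0 K * T powr \<eta>)"
      by (simp add: sum_distrib_left mult_ac)
    then show ?thesis using T by (simp only: mult_le_cancel_left_pos)
  qed
  show thesis
    by (rule that[of \<eta> "max 0 K"], use \<eta> in simp, simp, use main in blast)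
qed

text \<open>If |m|^2 \<ge> 2^k, some coordinate has square at least 2^k / d, so the d coordinate
  estimates with T = sqrt (d / 2^k) cover the tail. Then T^\<eta> decays like \<rho>^k with \<rho> =
  2^(-\<eta>/2); frequencies counted several times only enlarge the bound.\<close>

lemma sum_coeffU_tail_le:
  assumes \<beta>: "\<beta> > - 1/2" and a: "a > 0"
  obtains C \<rho> k0 where "0 < \<rho>" "\<rho> < 1"
    "\<And>k F. k \<ge> (k0 :: nat) \<Longrightarrow> finite F \<Longrightarrow> F \<subseteq> {m \<in> (int_lattice :: (real ^ 'd) set). 2 ^ k \<le> (norm m)\<^sup>2} \<Longrightarrow>
      (\<Sum>m\<in>F. (norm (coeffU \<beta> a m))\<^sup>2) \<le> C * \<rho> ^ k"
proof -
  obtain K \<eta> where \<eta>: "\<eta> > 0" "K \<ge> 0" and K: "\<And>F i T. finite F \<Longrightarrow> F \<subseteq> (int_lattice :: (real ^ 'd) set) \<Longrightarrow>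
    0 < T \<Longrightarrow> T \<le> 1 \<Longrightarrow> (\<And>m. m \<in> F \<Longrightarrow> 1 / T \<le> \<bar>m $ i\<bar>) \<Longrightarrow>
    (\<Sum>m\<in>F. (norm (coeffU \<beta> a m))\<^sup>2) \<le> K * T powr \<eta>"
    by (rule sum_coeffU_coordinate_tail_le[OF \<beta> a], rule that, assumption, assumption, blast)
  let ?d = "real CARD('d)"
  define \<rho> where "\<rho> = (1/2) powr (\<eta> / 2)"
  have \<rho>: "0 < \<rho>" "\<rho> < 1"
    using \<eta> powr_less_mono2[of "\<eta> / 2" "1/2" 1] by (auto simp: \<rho>_def)
  \<comment> \<open>This guarantees T \<le> 1 for all k \<ge> k0.\<close>
  obtain k0 where k0: "?d < 2 ^ k0"
    using real_arch_pow[of 2 ?d] by auto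
  have main: "(\<Sum>m\<in>F. (norm (coeffU \<beta> a m))\<^sup>2) \<le> (?d * K * ?d powr (\<eta> / 2)) * \<rho> ^ k"
    if k: "k \<ge> k0" and F: "finite F" "F \<subseteq> {m \<in> (int_lattice :: (real ^ 'd) set). 2 ^ k \<le> (norm m)\<^sup>2}"
    for k F
  proof -
    let ?c = "\<lambda>m. (norm (coeffU \<beta> a m))\<^sup>2"
    define T where "T = sqrt (?d / 2 ^ k)"
    have "?d \<le> 2 ^ k"
      using k0 power_increasing[OF k, of "2 :: real"] by linarith
    then have T: "0 < T" "T \<le> 1" "T\<^sup>2 = ?d / 2 ^ k"
      by (auto simp: T_def)
    define F' where "F' i = {m \<in> F. 1 / T \<le> \<bar>m $ i\<bar>}" for i
    have "(\<Sum>m\<in>F. ?c m) \<le> (\<Sum>m\<in>F. \<Sum>i\<in>UNIV. if m \<in> F' i then ?c m else 0)"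
    proof (rule sum_mono)
      fix m assume m: "m \<in> F"
      have "\<exists>i. 1 / T \<le> \<bar>m $ i\<bar>"
      proof (rule ccontr)
        assume "\<nexists>i. 1 / T \<le> \<bar>m $ i\<bar>"
        then have "\<bar>m $ i\<bar> < 1 / T" for i by (simp add: not_le)
        then have "\<bar>m $ i\<bar>\<^sup>2 < (1 / T)\<^sup>2" for i by (intro power_strict_mono) auto
        then have "(\<Sum>i\<in>UNIV. (m $ i)\<^sup>2) < (\<Sum>i\<in>(UNIV :: 'd set). (1 / T)\<^sup>2)"
          by (intro sum_strict_mono) auto
        moreover have "(\<Sum>i\<in>UNIV. (m $ i)\<^sup>2) = (norm m)\<^sup>2"
          by (simp add: norm_vec_def L2_set_def sum_nonneg)
        ultimately have "(norm m)\<^sup>2 < 2 ^ k"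
          using T by (simp add: power_divide)
        then show False using m F by auto
      qed
      then obtain i where "m \<in> F' i" using m by (auto simp: F'_def)
      then show "?c m \<le> (\<Sum>i\<in>UNIV. if m \<in> F' i then ?c m else 0)"
        using member_le_sum[of i UNIV "\<lambda>i. if m \<in> F' i then ?c m else 0"] by simp
    qed
    also have "\<dots> = (\<Sum>i\<in>UNIV. \<Sum>m\<in>F' i. ?c m)"
      using F by (subst sum.swap) (auto simp: F'_def sum.inter_filter intro!: sum.cong)
    also have "\<dots> \<le> (\<Sum>i\<in>(UNIV :: 'd set). K * T powr \<eta>)"
      using F T by (intro sum_mono K) (auto simp: F'_def)
    also have "\<dots> = ?d * K * T powr \<eta>" by simp
    also have "T powr \<eta> = ?d powr (\<eta> / 2) * \<rho> ^ k"
    proof -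
      have "T = (?d / 2 ^ k) powr (1/2)"
        by (simp add: T_def powr_half_sqrt)
      then have "T powr \<eta> = (?d * (1/2) ^ k) powr (\<eta> / 2)"
        by (simp add: powr_powr power_divide)
      also have "\<dots> = ?d powr (\<eta> / 2) * ((1/2) ^ k) powr (\<eta> / 2)"
        by (rule powr_mult)
      also have "((1/2 :: real) ^ k) powr (\<eta> / 2) = \<rho> ^ k"
        by (simp add: \<rho>_def powr_power powr_realpow[symmetric] powr_powr mult.commute)
      finally show ?thesis .
    qed
    finally show ?thesis by (simp add: mult.assoc)
  qed
  show thesis
    by (rule that[of \<rho> k0]) (use \<rho> main in auto)
qed

section \<open>Convergence of the spherical sums\<close>

lemma power2_norm_int_lattice:
  assumes "m \<in> int_lattice"
  obtains n :: nat where "(norm m)\<^sup>2 = real n"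
proof -
  have "(norm m)\<^sup>2 \<in> \<int>"
    using inner_int_lattice[OF assms assms] by (simp add: power2_norm_eq_inner)
  then show thesis
    using that by (metis Ints_cases nonneg_int_cases of_int_0_le_iff of_int_of_nat_eq zero_le_power2)
qed

lemma finite_norm2_le: "finite {m \<in> (int_lattice :: (real ^ 'd) set). (norm m)\<^sup>2 \<le> r}"
proof (rule finite_subset[OF _ finite_int_lattice_le])
  show "{m \<in> (int_lattice :: (real ^ 'd) set). (norm m)\<^sup>2 \<le> r} \<subseteq> {m \<in> int_lattice. norm m \<le> sqrt r}"
    by (auto intro: real_le_rsqrt)
qed

text \<open>Squared norms of lattice points are integers, so \<open>norm2_shell n (Suc n)\<close> is
  the sphere |m|^2 = n and \<open>norm2_shell 0 N\<close> consists of the lattice points of an open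
  ball. The half-open form lets consecutive shells fit together without overlap.\<close>

definition norm2_shell :: "nat \<Rightarrow> nat \<Rightarrow> (real ^ 'd) set" where
  "norm2_shell i j = {m \<in> int_lattice. real i \<le> (norm m)\<^sup>2 \<and> (norm m)\<^sup>2 < real j}"

lemma norm2_shell: "finite (norm2_shell i j)" "norm2_shell i j \<subseteq> int_lattice"
  by (auto simp: norm2_shell_def intro: finite_subset[OF _ finite_norm2_le[of "real j"]])

lemma sum_norm2_shell:
  fixes g :: "real ^ 'd \<Rightarrow> 'b::comm_monoid_add"
  shows "(\<Sum>n\<in>{i..<j}. \<Sum>m\<in>norm2_shell n (Suc n). g m) = (\<Sum>m\<in>norm2_shell i j. g m)"
proof -
  have "(norm2_shell i j :: (real ^ 'd) set) = (\<Union>n\<in>{i..<j}. norm2_shell n (Suc n))"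
  proof (intro equalityI subsetI)
    fix m :: "real ^ 'd" assume m: "m \<in> norm2_shell i j"
    then obtain n where "(norm m)\<^sup>2 = real n"
      using power2_norm_int_lattice[of m] by (auto simp: norm2_shell_def)
    then show "m \<in> (\<Union>n\<in>{i..<j}. norm2_shell n (Suc n))"
      using m by (auto simp: norm2_shell_def)
  next
    fix m :: "real ^ 'd" assume "m \<in> (\<Union>n\<in>{i..<j}. norm2_shell n (Suc n))"
    then obtain n where n: "i \<le> n" "Suc n \<le> j" "m \<in> norm2_shell n (Suc n)" by auto
    then have "real i \<le> real n" "real (Suc n) \<le> real j" by linarith+
    then show "m \<in> norm2_shell i j"
      using n(3) by (auto simp: norm2_shell_def)
  qed
  moreover have "norm2_shell n (Suc n) \<inter> (norm2_shell n' (Suc n') :: (real ^ 'd) set) = {}" if "n \<noteq> n'" for n n'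
  proof -
    have "Suc n \<le> n' \<or> Suc n' \<le> n" using that by linarith
    then have "real (Suc n) \<le> real n' \<or> real (Suc n') \<le> real n" by linarith
    then show ?thesis by (auto simp: norm2_shell_def)
  qed
  ultimately show ?thesis
    by (simp add: sum.UNION_disjoint norm2_shell(1))
qed

theorem theorem1p5:
  fixes \<beta> a :: real
  assumes "CARD('d::finite) \<ge> 4"
    and "\<beta> > - 1/2"
    and "a > 0"
  shows "AE x in lebesgue_on (torus :: (real ^ 'd) set).
           ((\<lambda>r. spherical_sum r (\<lambda>y. complex_of_real (periodU \<beta> a y)) x)
              \<longlongrightarrow> complex_of_real (periodU \<beta> a x)) at_top"
proof -
  define u :: "real ^ 'd \<Rightarrow> complex" where "u x = complex_of_real (periodU \<beta> a x)" for x
  define c where "c = fourier_coeff u"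
  have c_eq: "c = coeffU \<beta> a" by (simp add: c_def u_def[abs_def])
  interpret u: square_integrable u
    unfolding u_def[abs_def] by (rule square_integrable_periodU[OF assms(2,3)])
  \<comment> \<open>All frequencies of one sphere form a single term of the series, and
    \<open>b n\<close> is the mean square of that term.\<close>
  define P where "P n = trig_poly (norm2_shell n (Suc n)) c" for n
  define b where "b n = (\<Sum>m\<in>norm2_shell n (Suc n). (norm (c m))\<^sup>2)" for n
  define S where "S N x = (\<Sum>n<N. P n x)" for N x
  have P_sum: "(\<Sum>n\<in>{i..<j}. P n x) = trig_poly (norm2_shell i j) c x" for i j x
    unfolding P_def trig_poly_def by (rule sum_norm2_shell)
  have S_eq: "S N = trig_poly (norm2_shell 0 N) c" for N
    by (rule ext) (simp add: S_def lessThan_atLeast0 P_sum)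
  have conv: "AE x in torus_measure. convergent (\<lambda>N. S N x)"
  proof -
    obtain C \<rho> and k0 :: nat where \<rho>: "0 < \<rho>" "\<rho> < 1" and
      tail: "\<And>k F. k \<ge> k0 \<Longrightarrow> finite F \<Longrightarrow> F \<subseteq> {m \<in> (int_lattice :: (real ^ 'd) set). 2 ^ k \<le> (norm m)\<^sup>2} \<Longrightarrow>
        (\<Sum>m\<in>F. (norm (coeffU \<beta> a m))\<^sup>2) \<le> C * \<rho> ^ k"
      by (rule sum_coeffU_tail_le[OF assms(2,3), where 'd = 'd]) blast
    show ?thesis
      unfolding S_def
    proof (rule AE_convergent_dyadic_blocks[OF _ _ _ \<rho>])
      fix i j
      show "integrable torus_measure (\<lambda>x. (norm (\<Sum>n\<in>{i..<j}. P n x))\<^sup>2)"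
        unfolding P_sum by (rule square_integrable.int2[OF square_integrable_trig_poly])
      show "(LINT x|torus_measure. (norm (\<Sum>n\<in>{i..<j}. P n x))\<^sup>2) \<le> (\<Sum>n\<in>{i..<j}. b n)"
        unfolding P_sum b_def sum_norm2_shell
        by (simp add: integral_norm2_trig_poly norm2_shell)
    next
      fix k assume "k \<ge> k0"
      then show "(\<Sum>n\<in>{2 ^ k..<2 ^ Suc k}. b n) \<le> C * \<rho> ^ k"
        \<comment> \<open>The indices of the block make up the shell 2^k \<le> |m|^2 < 2^(k+1), a
          finite set to which the tail bound applies.\<close>
        unfolding b_def sum_norm2_shell c_eq
        by (intro tail norm2_shell) (auto simp: norm2_shell_def)
    qed
  qed
  have L2: "(\<lambda>N. LINT x|torus_measure. (norm (u x - S N x))\<^sup>2) \<longlonglongrightarrow> 0"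
  proof (rule LIMSEQ_I)
    fix e :: real assume e: "e > 0"
    obtain F p where F: "finite F" "F \<subseteq> int_lattice"
      and p: "(LINT x|torus_measure. (norm (u x - trig_poly F p x))\<^sup>2) < e"
      using trig_approximable_real[OF square_integrable_periodU[OF assms(2,3)]] e
      unfolding u_def trig_approximable_def trig_function_def by blast
    obtain N0 :: nat where N0: "\<And>m. m \<in> F \<Longrightarrow> (norm m)\<^sup>2 < real N0"
    proof -
      obtain N0 :: nat where "Max (insert 0 ((\<lambda>m. (norm m)\<^sup>2) ` F)) < real N0"
        using reals_Archimedean2 by blast
      then show ?thesis using F(1) by (intro that[of N0]) auto
    qed
    show "\<exists>N0. \<forall>N\<ge>N0. norm ((LINT x|torus_measure. (norm (u x - S N x))\<^sup>2) - 0) < e"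
    proof (intro exI allI impI)
      fix N assume N: "N \<ge> N0"
      let ?u = "LINT x|torus_measure. (norm (u x))\<^sup>2"
      \<comment> \<open>Once the ball contains \<open>F\<close>, the Fourier sum \<open>S N\<close>
        is the best approximation over a larger set of frequencies, hence at least as close to
        \<open>u\<close> as the polynomial with frequencies in \<open>F\<close>.\<close>
      have "F \<subseteq> norm2_shell 0 N"
        using F N0 N by (fastforce simp: norm2_shell_def)
      then have "(\<Sum>m\<in>F. (norm (c m))\<^sup>2) \<le> (\<Sum>m\<in>norm2_shell 0 N. (norm (c m))\<^sup>2)"
        by (intro sum_mono2 norm2_shell) auto
      moreover have "(LINT x|torus_measure. (norm (u x - S N x))\<^sup>2)
          = ?u - (\<Sum>m\<in>norm2_shell 0 N. (norm (c m))\<^sup>2)"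
        unfolding S_eq c_def
        by (subst integral_norm2_diff_trig_poly) (auto simp: norm2_shell u.square_integrable_axioms)
      moreover have "?u - (\<Sum>m\<in>F. (norm (c m))\<^sup>2) \<le> (LINT x|torus_measure. (norm (u x - trig_poly F p x))\<^sup>2)"
        unfolding c_def
        by (subst integral_norm2_diff_trig_poly) (auto simp: F u.square_integrable_axioms sum_nonneg)
      moreover have "0 \<le> (LINT x|torus_measure. (norm (u x - S N x))\<^sup>2)" by simp
      ultimately show "norm ((LINT x|torus_measure. (norm (u x - S N x))\<^sup>2) - 0) < e"
        using p by simp
    qed
  qed
  \<comment> \<open>Mean square convergence gives pointwise convergence only along a subsequence.
    Since the whole sequence converges almost everywhere, this suffices to determine its
    limit.\<close>
  have "\<exists>r :: nat \<Rightarrow> nat. strict_mono r \<and>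
      (AE x in torus_measure. (\<lambda>n. (norm (u x - S (r n) x))\<^sup>2) \<longlonglongrightarrow> 0)"
  proof (rule tendsto_L1_AE_subseq)
    show "integrable torus_measure (\<lambda>x. (norm (u x - S n x))\<^sup>2)" for n
      unfolding S_eq
      by (rule square_integrable.int2[OF square_integrable_diff[OF u.square_integrable_axioms
            square_integrable_trig_poly]])
    show "(\<lambda>n. LINT x|torus_measure. norm ((norm (u x - S n x))\<^sup>2)) \<longlonglongrightarrow> 0"
      using L2 by simp
  qed
  then obtain r :: "nat \<Rightarrow> nat" where r: "strict_mono r"
    and sub: "AE x in torus_measure. (\<lambda>n. (norm (u x - S (r n) x))\<^sup>2) \<longlonglongrightarrow> 0"
    by blast
  have ball: "spherical_sum R u x = S (nat \<lceil>R\<^sup>2\<rceil>) x" if R: "R > 0" for R x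
  proof -
    \<comment> \<open>For an integer n, n < R^2 holds exactly if n is below the ceiling of R^2, so
      the strict inequality |m| < R survives the rounding.\<close>
    have "{m \<in> (int_lattice :: (real ^ 'd) set). norm m < R} = norm2_shell 0 (nat \<lceil>R\<^sup>2\<rceil>)"
    proof (intro equalityI subsetI)
      fix m :: "real ^ 'd" assume m: "m \<in> {m \<in> int_lattice. norm m < R}"
      then have "(norm m)\<^sup>2 < R\<^sup>2" by (intro power_strict_mono) auto
      also have "R\<^sup>2 \<le> real (nat \<lceil>R\<^sup>2\<rceil>)" by (rule real_nat_ceiling_ge)
      finally show "m \<in> norm2_shell 0 (nat \<lceil>R\<^sup>2\<rceil>)" using m by (simp add: norm2_shell_def)
    next
      fix m :: "real ^ 'd" assume "m \<in> norm2_shell 0 (nat \<lceil>R\<^sup>2\<rceil>)"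
      then have m: "m \<in> int_lattice" "(norm m)\<^sup>2 < real (nat \<lceil>R\<^sup>2\<rceil>)" by (auto simp: norm2_shell_def)
      obtain n where n: "(norm m)\<^sup>2 = real n" by (rule power2_norm_int_lattice[OF m(1)])
      have "int n < \<lceil>R\<^sup>2\<rceil>" using m(2) n by linarith
      then have "real n < R\<^sup>2" by (simp add: less_ceiling_iff)
      then have "norm m < R" using n R by (intro power2_less_imp_less[of "norm m" R]) auto
      then show "m \<in> {m \<in> int_lattice. norm m < R}" using m by simp
    qed
    then show ?thesis by (simp add: spherical_sum_eq S_eq c_def)
  qed
  from conv sub show ?thesis
    unfolding u_def[symmetric]
  proof eventually_elim
    case (elim x)
    then obtain l where l: "(\<lambda>N. S N x) \<longlonglongrightarrow> l" by (auto simp: convergent_def)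
    have "(\<lambda>n. S (r n) x) \<longlonglongrightarrow> l"
      using LIMSEQ_subseq_LIMSEQ[OF l r] by (simp add: o_def)
    then have "(\<lambda>n. (norm (u x - S (r n) x))\<^sup>2) \<longlonglongrightarrow> (norm (u x - l))\<^sup>2"
      by (intro tendsto_intros)
    then have "(norm (u x - l))\<^sup>2 = 0" using elim(2) LIMSEQ_unique by blast
    then have "(\<lambda>N. S N x) \<longlonglongrightarrow> u x" using l by simp
    moreover have "filterlim (\<lambda>R :: real. nat \<lceil>R\<^sup>2\<rceil>) sequentially at_top"
      unfolding filterlim_at_top
    proof
      fix Z :: nat
      show "eventually (\<lambda>R :: real. Z \<le> nat \<lceil>R\<^sup>2\<rceil>) at_top"
        using eventually_ge_at_top[of "max 1 (real Z)"]
      proof eventually_elim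
        case (elim R)
        then have "1 * R \<le> R * R" by (intro mult_right_mono) auto
        with elim have "real Z \<le> R * R" by linarith
        then have "real Z \<le> R\<^sup>2" by (simp add: power2_eq_square)
        also have "\<dots> \<le> real (nat \<lceil>R\<^sup>2\<rceil>)" by (rule real_nat_ceiling_ge)
        finally show ?case by simp
      qed
    qed
    ultimately have "((\<lambda>R :: real. S (nat \<lceil>R\<^sup>2\<rceil>) x) \<longlongrightarrow> u x) at_top"
      by (rule filterlim_compose)
    moreover have "eventually (\<lambda>R :: real. S (nat \<lceil>R\<^sup>2\<rceil>) x = spherical_sum R u x) at_top"
      using eventually_gt_at_top[of 0] by eventually_elim (simp add: ball)
    ultimately show ?case by (rule Lim_transform_eventually)
  qed
qed

end
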